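(* There exists a partially hyperbolic endomorphism $f:\mathbb{T}^2\to\mathbb{T}^2$ with non-hyperbolic linearisation that is dynamically incoherent (i.e. not dynamically coherent).
   Context: $\mathbb{T}^2=\mathbb{R}^2/\mathbb{Z}^2$. A cone family $\mathcal{C}\subset T\mathbb{T}^2$ consists of a closed convex cone $\mathcal{C}(p)\subset T_p\mathbb{T}^2$ at each point $p$; as usual, the cones vary continuously with $p$ and are two-sided, i.e. $\mathcal{C}(p)=S\cup(-S)$ with $S$ a closed convex sector with nonempty interior and angle less than $\pi$. It is $Df$-invariant if $D_pf(\mathcal{C}(p))$ is contained (apart from the zero vector) in the interior of $\mathcal{C}(f(p))$ for all $p$. A map $f:\mathbb{T}^2\to\mathbb{T}^2$ is a (weakly) partially hyperbolic endomorphism if it is a ($C^1$) local diffeomorphism and it admits a $Df$-invariant cone family $\mathcal{C}^u$ (an unstable cone family) such that $1<\|Df\,v^u\|$ for all unit vectors $v^u\in\mathcal{C}^u$, with respect to some Riemannian metric. Such an $f$ has a centre direction: a continuous $Df$-invariant line field $E^c\subset T\mathbb{T}^2$, where $E^c(p)$ is the unique line in $T_p\mathbb{T}^2$ such that $Df^n(E^c(p))$ meets $\mathcal{C}^u(f^n(p))$ only at $0$ for all $n\ge 0$. $f$ is dynamically coherent if there exists an $f$-invariant foliation of $\mathbb{T}^2$ (i.e. $f$ maps leaves to leaves) with $C^1$ leaves tangent to $E^c$. The linearisation of $f$ is the unique linear toral endomorphism $A:\mathbb{T}^2\to\mathbb{T}^2$ inducing the same homomorphism of $\pi_1(\mathbb{T}^2)\cong\mathbb{Z}^2$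 as $f$. If $\lambda_1,\lambda_2$ are the eigenvalues of the integer matrix inducing $A$, then $A$ is non-hyperbolic if (up to ordering) $1<|\lambda_1|$ and $|\lambda_2|=1$. *)

theory Defs
  imports "HOL-Analysis.Analysis"
begin

section \<open>The torus\<close>

quotient_type torus = "real^2" / "\<lambda>x y. \<forall>i. x $ i - y $ i \<in> \<int>"
  morphisms rep_torus torus_proj
proof (rule equivpI)
  show "reflp (\<lambda>x y::real^2. \<forall>i. x $ i - y $ i \<in> \<int>)"
    by (simp add: reflp_def)
  show "symp (\<lambda>x y::real^2. \<forall>i. x $ i - y $ i \<in> \<int>)"
    by (rule sympI) (metis Ints_minus minus_diff_eq)
  show "transp (\<lambda>x y::real^2. \<forall>i. x $ i - y $ i \<in> \<int>)"
  proof (rule transpI, rule allI)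
    fix x y z :: "real^2" and i
    assume "\<forall>i. x $ i - y $ i \<in> \<int>" "\<forall>i. y $ i - z $ i \<in> \<int>"
    then have "(x $ i - y $ i) + (y $ i - z $ i) \<in> \<int>"
      using Ints_add by blast
    then show "x $ i - z $ i \<in> \<int>" by simp
  qed
qed

lemma torus_proj_eq_iff: "torus_proj x = torus_proj y \<longleftrightarrow> (\<forall>i. x $ i - y $ i \<in> \<int>)"
  using torus.abs_eq_iff by blast

lemma torus_proj_surj: "\<exists>x. torus_proj x = p"
  using Quotient3_abs_rep[OF Quotient3_torus, of p] by (rule exI)

instantiation torus :: topological_space
begin

definition open_torus :: "torus set \<Rightarrow> bool"
  where "open_torus U \<longleftrightarrow> open (torus_proj -` U)"

instance
proof
  show "open (UNIV :: torus set)"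
    by (simp add: open_torus_def)
  show "open (S \<inter> T)" if "open S" "open T" for S T :: "torus set"
    using that by (simp add: open_torus_def open_Int)
  show "open (\<Union>K)" if "\<forall>S\<in>K. open S" for K :: "torus set set"
    using that by (simp add: open_torus_def vimage_Union open_UN)
qed

end

lemma continuous_on_torus_proj: "continuous_on S torus_proj"
proof (rule continuous_on_subset)
  show "continuous_on UNIV torus_proj"
    unfolding continuous_on_open_vimage[OF open_UNIV] by (simp add: open_torus_def)
qed simp

section \<open>Calculus on the torus\<close>

text \<open>Every tangent space of the torus is identified with \<open>real^2\<close> through the
  projection. Near a given point, local inverses of the projection are charts; in such charts
  the map \<open>f\<close> is a local lift \<open>F\<close>.\<close>

definition has_torus_derivative ::
    "(torus \<Rightarrow> torus) \<Rightarrow> (real^2 \<Rightarrow> real^2) \<Rightarrow> torus \<Rightarrow> bool" where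
  "has_torus_derivative f L p \<longleftrightarrow>
     (\<exists>x F. torus_proj x = p \<and>
        (\<forall>\<^sub>F y in nhds x. torus_proj (F y) = f (torus_proj y)) \<and>
        (F has_derivative L) (at x))"

definition torus_deriv :: "(torus \<Rightarrow> torus) \<Rightarrow> torus \<Rightarrow> real^2 \<Rightarrow> real^2" where
  "torus_deriv f p = (THE L. has_torus_derivative f L p)"

lemma has_torus_derivative_unique:
  assumes "has_torus_derivative f L p" "has_torus_derivative f L' p"
  shows "L = L'"
proof -
  obtain x F where x: "torus_proj x = p" and F: "(F has_derivative L) (at x)"
      and lift: "\<forall>\<^sub>F y in nhds x. torus_proj (F y) = f (torus_proj y)"
    using assms(1) unfolding has_torus_derivative_def by blast
  obtain x' F' where x': "torus_proj x' = p" and F': "(F' has_derivative L') (at x')"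
      and lift': "\<forall>\<^sub>F y in nhds x'. torus_proj (F' y) = f (torus_proj y)"
    using assms(2) unfolding has_torus_derivative_def by blast
  define t where "t = x' - x"
  define G where "G = (\<lambda>y. F' (y + t))"
  have t_int: "t $ i \<in> \<int>" for i
    using x x' torus_proj_eq_iff[of x' x] by (simp add: t_def)
  have shift: "torus_proj (y + t) = torus_proj y" for y
    using t_int by (simp add: torus_proj_eq_iff)
  have tends: "((\<lambda>y. y + t) \<longlongrightarrow> x') (nhds x)"
    by (rule tendsto_eq_rhs[OF tendsto_add[OF filterlim_ident tendsto_const]]) (simp add: t_def)
  have liftG: "\<forall>\<^sub>F y in nhds x. torus_proj (G y) = f (torus_proj y)"
    using eventually_compose_filterlim[OF lift' tends] by (simp add: G_def shift)
  have G: "(G has_derivative L') (at x)"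
  proof -
    have "((\<lambda>y. y + t) has_derivative (\<lambda>h. h)) (at x)"
      by (auto intro!: derivative_eq_intros)
    moreover have "(F' has_derivative L') (at (x + t))"
      using F' by (simp add: t_def)
    ultimately show ?thesis
      unfolding G_def using has_derivative_compose by fastforce
  qed
  define d where "d = (\<lambda>y. F y - G y)"
  have d: "(d has_derivative (\<lambda>h. L h - L' h)) (at x)"
    unfolding d_def using F G by (rule has_derivative_diff)
  have "isCont d x"
    using d has_derivative_continuous by blast
  then have "(d \<longlongrightarrow> d x) (nhds x)"
    by (simp add: isCont_def tendsto_at_iff_tendsto_nhds)
  then have near: "\<forall>\<^sub>F y in nhds x. dist (d y) (d x) < 1"
    by (rule tendstoD) simp
  have int: "\<forall>\<^sub>F y in nhds x. \<forall>i. d y $ i \<in> \<int>"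
    using lift liftG
  proof eventually_elim
    case (elim y)
    then have "torus_proj (F y) = torus_proj (G y)" by simp
    then have "\<forall>i. F y $ i - G y $ i \<in> \<int>"
      by (rule torus_proj_eq_iff[THEN iffD1])
    then show ?case by (simp add: d_def)
  qed
  then have int_x: "d x $ i \<in> \<int>" for i
    using eventually_nhds_x_imp_x[OF int] by blast
  have const: "\<forall>\<^sub>F y in nhds x. d y = d x"
    using near int
  proof eventually_elim
    case (elim y)
    show ?case
    proof (rule vec_eq_iff[THEN iffD2], rule allI)
      fix i
      have "\<bar>d y $ i - d x $ i\<bar> < 1"
        using elim(1) component_le_norm_cart[of "d y - d x" i] by (simp add: dist_norm)
      moreover have "d y $ i - d x $ i \<in> \<int>"
        using elim(2) int_x by auto
      ultimately show "d y $ i = d x $ i"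
        using Ints_nonzero_abs_less1 by force
    qed
  qed
  have "(d has_derivative (\<lambda>h. 0)) (at x)"
    by (rule has_derivative_transform_eventually[OF has_derivative_const[of "d x"]])
       (use const in \<open>auto simp: eventually_at_filter elim: eventually_mono\<close>)
  then have "(\<lambda>h. L h - L' h) = (\<lambda>h. 0)"
    using d has_derivative_unique by blast
  then show ?thesis
    by (auto simp: fun_eq_iff)
qed

lemma torus_deriv_eq: "has_torus_derivative f L p \<Longrightarrow> torus_deriv f p = L"
  unfolding torus_deriv_def using has_torus_derivative_unique by blast


definition C1_torus_on :: "torus set \<Rightarrow> (torus \<Rightarrow> torus) \<Rightarrow> bool" where
  "C1_torus_on U f \<longleftrightarrow>
     (\<forall>p\<in>U. \<exists>L. has_torus_derivative f L p) \<and>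
     (\<forall>v. continuous_on U (\<lambda>p. torus_deriv f p v))"

definition C1_local_diffeo :: "(torus \<Rightarrow> torus) \<Rightarrow> bool" where
  "C1_local_diffeo f \<longleftrightarrow>
     (\<forall>p. \<exists>U V g. open U \<and> p \<in> U \<and> open V \<and> homeomorphism U V f g \<and>
        C1_torus_on U f \<and> C1_torus_on V g)"

text \<open>Smooth means infinitely often differentiable: all iterated directional derivatives
  are differentiable.\<close>

coinductive smooth :: "(real^2 \<Rightarrow> real) \<Rightarrow> bool" where
  "(\<And>x. h differentiable (at x)) \<Longrightarrow> (\<And>v. smooth (\<lambda>x. frechet_derivative h (at x) v))
     \<Longrightarrow> smooth h"

definition riemannian_metric :: "(torus \<Rightarrow> real^2 \<Rightarrow> real^2 \<Rightarrow> real) \<Rightarrow> bool" where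
  "riemannian_metric g \<longleftrightarrow>
     (\<forall>p. bilinear (g p) \<and> (\<forall>u v. g p u v = g p v u) \<and> (\<forall>v. v \<noteq> 0 \<longrightarrow> 0 < g p v v)) \<and>
     (\<forall>u v. smooth (\<lambda>x. g (torus_proj x) u v))"

definition metric_norm ::
    "(torus \<Rightarrow> real^2 \<Rightarrow> real^2 \<Rightarrow> real) \<Rightarrow> torus \<Rightarrow> real^2 \<Rightarrow> real" where
  "metric_norm g p v = sqrt (g p v v)"

section \<open>Partially hyperbolic endomorphisms\<close>

definition sector :: "real \<Rightarrow> real \<Rightarrow> (real^2) set" where
  "sector a b = {r *\<^sub>R vector [cos t, sin t] |r t. 0 \<le> r \<and> a \<le> t \<and> t \<le> b}"

text \<open>Only local continuity of the bounding angles is required: a cone family need not be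
  orientable, so in general neither the angles nor the choice of one of the two opposite
  sectors extend continuously to the whole torus.\<close>

definition cone_family :: "(torus \<Rightarrow> (real^2) set) \<Rightarrow> bool" where
  "cone_family C \<longleftrightarrow>
     (\<forall>p. \<exists>U a b. open U \<and> p \<in> U \<and> continuous_on U a \<and> continuous_on U b \<and>
        (\<forall>q\<in>U. 0 < b q - a q \<and> b q - a q < pi \<and>
           C q = sector (a q) (b q) \<union> uminus ` sector (a q) (b q)))"

definition unstable_cone_family :: "(torus \<Rightarrow> torus) \<Rightarrow> (torus \<Rightarrow> (real^2) set) \<Rightarrow> bool" where
  "unstable_cone_family f C \<longleftrightarrow>
     cone_family C \<and>
     (\<forall>p. torus_deriv f p ` C p - {0} \<subseteq> interior (C (f p))) \<and>
     (\<exists>g. riemannian_metric g \<and>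
        (\<forall>p. \<forall>v\<in>C p. metric_norm g p v = 1 \<longrightarrow> 1 < metric_norm g (f p) (torus_deriv f p v)))"

definition partially_hyperbolic :: "(torus \<Rightarrow> torus) \<Rightarrow> bool" where
  "partially_hyperbolic f \<longleftrightarrow> C1_local_diffeo f \<and> (\<exists>C. unstable_cone_family f C)"

definition is_line :: "(real^2) set \<Rightarrow> bool" where
  "is_line l \<longleftrightarrow> subspace l \<and> dim l = 1"

text \<open>At every point, \<open>E p\<close> is the one and only line all of whose forward images avoid the
  cones of \<open>C\<close>.\<close>

definition centre_direction ::
    "(torus \<Rightarrow> torus) \<Rightarrow> (torus \<Rightarrow> (real^2) set) \<Rightarrow> (torus \<Rightarrow> (real^2) set) \<Rightarrow> bool" where
  "centre_direction f C E \<longleftrightarrow>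
     (\<forall>p l. is_line l \<and> (\<forall>n. torus_deriv (f ^^ n) p ` l \<inter> C ((f ^^ n) p) = {0}) \<longleftrightarrow> l = E p)"

section \<open>Dynamical coherence\<close>

text \<open>Curves on the torus are written as projections of curves in the plane.\<close>

definition C1_curve_tangent_to :: "(torus \<Rightarrow> (real^2) set) \<Rightarrow> torus set \<Rightarrow> bool" where
  "C1_curve_tangent_to E L \<longleftrightarrow>
     (\<exists>c c'. L = range (\<lambda>t::real. torus_proj (c t)) \<and>
        (\<forall>t. (c has_vector_derivative c' t) (at t)) \<and> continuous_on UNIV c' \<and>
        (\<forall>t. c' t \<noteq> 0 \<and> c' t \<in> E (torus_proj (c t))))"

text \<open>\<open>W\<close> is the set of leaves. In a foliation chart the plaques, i.e. the components of the
  intersections of the leaves with the domain of the chart, are the horizontal segments. The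
  charts are only required to be homeomorphisms; the leaves are \<open>C\<^sup>1\<close> immersed curves.\<close>

definition foliation_tangent_to :: "(torus \<Rightarrow> (real^2) set) \<Rightarrow> torus set set \<Rightarrow> bool" where
  "foliation_tangent_to E W \<longleftrightarrow>
     \<Union>W = UNIV \<and> disjoint W \<and>
     (\<forall>L\<in>W. C1_curve_tangent_to E L) \<and>
     (\<forall>p. \<exists>U \<phi> \<psi>. open U \<and> p \<in> U \<and>
        homeomorphism U ({0<..<1::real} \<times> {0<..<1::real}) \<phi> \<psi> \<and>
        (\<forall>L\<in>W. \<forall>K\<in>components (L \<inter> U). \<exists>y. \<phi> ` K = {0<..<1} \<times> {y}))"

definition dynamically_coherent :: "(torus \<Rightarrow> torus) \<Rightarrow> bool" where
  "dynamically_coherent f \<longleftrightarrow>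
     (\<exists>C E W. unstable_cone_family f C \<and> centre_direction f C E \<and>
        foliation_tangent_to E W \<and> (\<forall>L\<in>W. f ` L \<in> W))"

section \<open>Linearisation\<close>

lemma int_matrix_congruence:
  fixes M :: "int^2^2" and x y :: "real^2"
  assumes "\<forall>i. x $ i - y $ i \<in> \<int>"
  shows "\<forall>i. (map_matrix of_int M *v x) $ i - (map_matrix of_int M *v y) $ i \<in> \<int>"
proof
  fix i
  have "(map_matrix of_int M *v x) $ i - (map_matrix of_int M *v y) $ i
      = (\<Sum>j\<in>UNIV. of_int (M $ i $ j) * (x $ j - y $ j))"
    by (simp add: matrix_vector_mult_def sum_subtractf right_diff_distrib)
  also have "\<dots> \<in> \<int>"
    using assms by (intro Ints_sum Ints_mult) auto
  finally show "(map_matrix of_int M *v x) $ i - (map_matrix of_int M *v y) $ i \<in> \<int>" .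
qed

definition toral_endo :: "int^2^2 \<Rightarrow> torus \<Rightarrow> torus" where
  "toral_endo M p = torus_proj (map_matrix of_int M *v rep_torus p)"

lemma toral_endo_torus_proj:
  "toral_endo M (torus_proj x) = torus_proj (map_matrix of_int M *v x)"
proof -
  have "torus_proj (rep_torus (torus_proj x)) = torus_proj x"
    by (rule Quotient3_abs_rep[OF Quotient3_torus])
  then have "\<forall>i. rep_torus (torus_proj x) $ i - x $ i \<in> \<int>"
    by (rule torus_proj_eq_iff[THEN iffD1])
  then show ?thesis
    unfolding toral_endo_def torus_proj_eq_iff by (rule int_matrix_congruence)
qed

text \<open>The fundamental group of the torus is abelian, so free homotopy classes of loops are the
  elements of the fundamental group, independently of base points. Hence two continuous maps
  induce the same homomorphism iff they send every loop to freely homotopic loops.\<close>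

definition same_on_pi1 :: "(torus \<Rightarrow> torus) \<Rightarrow> (torus \<Rightarrow> torus) \<Rightarrow> bool" where
  "same_on_pi1 f h \<longleftrightarrow>
     (\<forall>\<gamma>. path \<gamma> \<and> pathfinish \<gamma> = pathstart \<gamma> \<longrightarrow> homotopic_loops UNIV (f \<circ> \<gamma>) (h \<circ> \<gamma>))"

definition is_linearisation :: "(torus \<Rightarrow> torus) \<Rightarrow> int^2^2 \<Rightarrow> bool" where
  "is_linearisation f M \<longleftrightarrow> same_on_pi1 f (toral_endo M)"

definition is_eigenvalue :: "int^2^2 \<Rightarrow> complex \<Rightarrow> bool" where
  "is_eigenvalue M z \<longleftrightarrow> (\<exists>v::complex^2. v \<noteq> 0 \<and> map_matrix of_int M *v v = z *s v)"

text \<open>Eigenvalues of different modulus are distinct, so \<open>z\<close> and \<open>w\<close> are the two eigenvalues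
  of the \<open>2 \<times> 2\<close> matrix \<open>M\<close>.\<close>

definition non_hyperbolic :: "int^2^2 \<Rightarrow> bool" where
  "non_hyperbolic M \<longleftrightarrow>
     (\<exists>z w. is_eigenvalue M z \<and> is_eigenvalue M w \<and> 1 < cmod z \<and> cmod w = 1)"

end

theory Submission
  imports Defs
begin

text \<open>
  The example is a skew product \<open>(x, y) \<mapsto> (2x + \<theta>(y), c(y))\<close>, where \<open>c\<close> is a circle
  diffeomorphism (lifted to \<open>circ\<close>, while \<open>\<theta>\<close> is \<open>shear\<close>) with a repelling fixed point \<open>0\<close> of
  multiplier \<open>4\<close> and an attracting fixed point \<open>1/2\<close> of multiplier \<open>1/4\<close>. Removing the shear \<open>\<theta>\<close> and straightening \<open>c\<close> linearly gives a
  homotopy to \<open>diag(2, 1)\<close>, which is not hyperbolic.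

  Horizontal vectors are multiplied by \<open>2\<close> everywhere. On the circle \<open>y = 0\<close> this is less than
  \<open>c'(0) = 4\<close>, so that there the horizontal direction is the centre direction, whereas on the
  circle \<open>y = 1/2\<close> it is the unstable direction. In between, the centre direction has to turn, and
  the shear is chosen such that it does so explicitly. For \<open>0 \<le> y \<le> 1/2\<close> put \<open>a = sqrt(2y)\<close> and
  \<open>b = sqrt(1 - 2y)\<close>, so that \<open>a\<^sup>2 + b\<^sup>2 = 1\<close>, and let \<open>c\<close> be the map for which \<open>a/b\<close> doubles:
  \<open>(a, b)\<close> goes to \<open>(2a, b) / sqrt(1 + 3a\<^sup>2)\<close>. The centre curves are prescribed to be the horizontal
  translates of one curve \<open>x = \<chi>(y)\<close> with \<open>\<chi>' = b/a\<close>. Invariance forces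
  \<open>\<theta>' = c' (\<chi>' \<circ> c) - 2\<chi>'\<close>, and because \<open>c'(0) = 4 = 2\<^sup>2\<close> matches the singularity \<open>1/sqrt(y)\<close> of
  \<open>\<chi>'\<close>, the singular terms cancel and \<open>\<theta>'\<close> is continuous. So the map is \<open>C\<^sup>1\<close>, although its centre
  direction is only Hoelder continuous.

  In the frame \<open>unst = (a(1 + b\<^sup>2), -b\<^sup>3)\<close>, \<open>cent = (b, a)\<close> of determinant \<open>1\<close> the derivative is
  diagonal with entries \<open>4/d\<close> and \<open>2/d\<^sup>3\<close>, where \<open>d = sqrt(1 + 3a\<^sup>2)\<close> lies between \<open>1\<close> and \<open>2\<close>
  (\<open>dlift_unst\<close>, \<open>dlift_cent\<close>). The first entry dominates the second and is at least \<open>2\<close>, so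
  a cone around \<open>unst\<close> is an unstable cone family, even for the Euclidean metric
  (\<open>unstable_cone_family_ucone\<close>).

  The centre direction of any unstable cone family is spanned by \<open>cent\<close> (\<open>centre_direction_eq\<close>):
  off the circle \<open>y = 0\<close> the vectors \<open>cent\<close> are contracted by high iterates, so no cone field
  on which the derivative expands contains them; on the circle one perturbs to nearby points, as
  cones vary continuously and are mapped into interiors.

  Finally, \<open>b/a\<close> is integrable, so every centre curve \<open>x = \<alpha> + \<chi>(y)\<close> reaches the circle
  \<open>y = 0\<close> after finite length and is tangent to it there; this happens from both sides, and always in
  the same direction along the circle. A leaf through a point of the circle cannot leave the
  circle in this direction (\<open>leaf_stays_in_circle\<close>). On the other hand, plaques are closed
  in foliation charts, so the leaf of a point just above the circle contains the whole centre curve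
  down to the circle (\<open>leaf_reaches_circle\<close>). Hence one plaque contains an interval of the
  circle together with all centre curves that end in it, and therefore an open set: a contradiction
  (\<open>no_foliation\<close>).
\<close>

section \<open>Plane vectors and the projection onto the torus\<close>

lemma vector2_eq_iff: "v = w \<longleftrightarrow> v $ 1 = w $ 1 \<and> v $ 2 = (w $ 2 :: 'a)" for v w :: "'a^2"
  by (simp add: vec_eq_iff forall_2)

lemma vector2_axis: "vector [p, q] = p *\<^sub>R axis 1 1 + q *\<^sub>R (axis 2 1 :: real^2)"
  by (simp add: vector2_eq_iff axis_def)

lemma vector2_arith:
  "vector [a, b] + vector [c, d] = (vector [a + c, b + d] :: real^2)"
  "vector [a, b] - vector [c, d] = (vector [a - c, b - d] :: real^2)"
  "r *\<^sub>R vector [a, b] = (vector [r * a, r * b] :: real^2)"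
  "- vector [a, b] = (vector [- a, - b] :: real^2)"
  by (simp_all add: vector2_eq_iff)

lemma continuous_on_vector2 [continuous_intros]:
  "continuous_on A p \<Longrightarrow> continuous_on A q \<Longrightarrow> continuous_on A (\<lambda>z. vector [p z, q z] :: real^2)"
  unfolding vector2_axis by (intro continuous_intros)

lemma has_derivative_vector2 [derivative_intros]:
  "(p has_derivative p') F \<Longrightarrow> (q has_derivative q') F \<Longrightarrow>
    ((\<lambda>z. vector [p z, q z] :: real^2) has_derivative (\<lambda>h. vector [p' h, q' h])) F"
  unfolding vector2_axis by (intro derivative_intros)

lemma has_derivative_nth [derivative_intros]:
  "(p has_derivative p') F \<Longrightarrow> ((\<lambda>z. p z $ i) has_derivative (\<lambda>h. p' h $ i)) F"
  by (rule bounded_linear.has_derivative[OF bounded_linear_vec_nth])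

lemma torus_proj_add_int: "(\<And>i. t $ i \<in> \<int>) \<Longrightarrow> torus_proj (x + t) = torus_proj x"
  by (simp add: torus_proj_eq_iff)

lemma torus_proj_eqE:
  assumes "torus_proj x = torus_proj x'"
  obtains m n where "x $ 1 = x' $ 1 + of_int m" "x $ 2 = x' $ 2 + of_int n"
proof -
  have "x $ 1 - x' $ 1 \<in> \<int>" "x $ 2 - x' $ 2 \<in> \<int>"
    using assms by (auto simp: torus_proj_eq_iff)
  then obtain m n where "x $ 1 - x' $ 1 = of_int m" "x $ 2 - x' $ 2 = of_int n"
    by (auto elim!: Ints_cases)
  then show ?thesis by (intro that[of m n]) simp_all
qed

lemma torus_proj_rep [simp]: "torus_proj (rep_torus p) = p"
  by (rule Quotient3_abs_rep[OF Quotient3_torus])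

lemma torus_proj_cases: obtains x where "p = torus_proj x"
  using torus_proj_surj by metis

text \<open>The saturation of \<open>W\<close> is a union of integer translates of \<open>W\<close>. Openness of the projection is
  what makes statements about the plane descend to the quotient topology.\<close>

lemma open_torus_proj_image:
  assumes "open W" shows "open (torus_proj ` W)"
proof -
  have "torus_proj -` torus_proj ` W = (\<Union>t\<in>{t. \<forall>i. t $ i \<in> \<int>}. (\<lambda>x. t + x) ` W)"
  proof (intro set_eqI iffI)
    fix y assume "y \<in> torus_proj -` torus_proj ` W"
    then obtain x where x: "x \<in> W" "torus_proj y = torus_proj x" by auto
    then have "\<forall>i. (y - x) $ i \<in> \<int>" by (simp add: torus_proj_eq_iff)
    moreover have "y = (y - x) + x" by simp
    ultimately show "y \<in> (\<Union>t\<in>{t. \<forall>i. t $ i \<in> \<int>}. (\<lambda>x. t + x) ` W)"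
      using x(1) by blast
  next
    fix y assume "y \<in> (\<Union>t\<in>{t. \<forall>i. t $ i \<in> \<int>}. (\<lambda>x. t + x) ` W)"
    then obtain t x where "\<forall>i. t $ i \<in> \<int>" "x \<in> W" "y = t + x" by auto
    then show "y \<in> torus_proj -` torus_proj ` W"
      using torus_proj_add_int[of t x] by (auto simp: add.commute)
  qed
  also have "open \<dots>"
    using assms by (intro open_UN ballI open_translation) auto
  finally show ?thesis by (simp add: open_torus_def)
qed

lemma open_torus_proj_vimage: "open U \<Longrightarrow> open (torus_proj -` U)"
  by (simp add: open_torus_def)

text \<open>Two points of the ball have distance less than \<open>1\<close>, so their coordinates cannot differ by nonzero
  integers.\<close>

lemma inj_on_torus_proj_ball: "inj_on torus_proj (ball x (1/2))"
proof (rule inj_onI)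
  fix y z assume yz: "y \<in> ball x (1/2)" "z \<in> ball x (1/2)" and eq: "torus_proj y = torus_proj z"
  have "dist y z \<le> dist x y + dist x z" by (rule dist_triangle3)
  then have "norm (y - z) < 1" using yz by (simp add: dist_norm)
  then have "\<bar>(y - z) $ i\<bar> < 1" for i
    using component_le_norm_cart[of "y - z" i] by linarith
  moreover have "(y - z) $ i \<in> \<int>" for i using eq by (simp add: torus_proj_eq_iff)
  ultimately show "y = z"
    using Ints_nonzero_abs_less1 by (fastforce simp: vec_eq_iff)
qed

lemma homeomorphism_torus_proj:
  assumes "open W" "inj_on torus_proj W"
  shows "homeomorphism W (torus_proj ` W) torus_proj (inv_into W torus_proj)"
proof -
  have "continuous_on (torus_proj ` W) (inv_into W torus_proj)"
    unfolding continuous_on_open_vimage[OF open_torus_proj_image[OF assms(1)]]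
  proof (intro allI impI)
    fix B :: "(real^2) set" assume "open B"
    have "inv_into W torus_proj -` B \<inter> torus_proj ` W = torus_proj ` (B \<inter> W)"
      using assms(2) by (auto simp: image_iff)
    then show "open (inv_into W torus_proj -` B \<inter> torus_proj ` W)"
      using \<open>open B\<close> assms(1) by (simp add: open_torus_proj_image open_Int)
  qed
  then show ?thesis
    using assms(2) by (auto simp: homeomorphism_def continuous_on_torus_proj f_inv_into_f)
qed

text \<open>Functions on the torus that are defined through lifts are continuous because, locally, lifts of
  points can be chosen continuously.\<close>

lemma torus_local_section:
  obtains U \<sigma> where "open U" "torus_proj x \<in> U" "continuous_on U \<sigma>" "\<And>p. p \<in> U \<Longrightarrow> torus_proj (\<sigma> p) = p"
    "\<sigma> (torus_proj x) = x"
proof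
  let ?W = "ball x (1/2)"
  note inj = inj_on_torus_proj_ball[of x]
  show "open (torus_proj ` ?W)" by (rule open_torus_proj_image) simp
  show "torus_proj x \<in> torus_proj ` ?W" by simp
  show "continuous_on (torus_proj ` ?W) (inv_into ?W torus_proj)"
    using homeomorphism_torus_proj[OF open_ball inj] by (simp add: homeomorphism_def)
  show "torus_proj (inv_into ?W torus_proj p) = p" if "p \<in> torus_proj ` ?W" for p
    using that by (rule f_inv_into_f)
  show "inv_into ?W torus_proj (torus_proj x) = x"
    by (rule inv_into_f_f[OF inj]) simp
qed

lemma has_torus_derivative_lift:
  assumes "open W" "x \<in> W" "\<And>y. y \<in> W \<Longrightarrow> torus_proj (G y) = k (torus_proj y)"
    and "(G has_derivative L) (at x)"
  shows "has_torus_derivative k L (torus_proj x)"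
  unfolding has_torus_derivative_def
proof (intro exI conjI)
  show "\<forall>\<^sub>F y in nhds x. torus_proj (G y) = k (torus_proj y)"
    using eventually_nhds_in_open[OF assms(1,2)] by (rule eventually_mono) (rule assms(3))
qed (use assms(4) in simp_all)

lemma C1_torus_on_lift:
  assumes W: "open W" "inj_on torus_proj W"
    and lift: "\<And>y. y \<in> W \<Longrightarrow> torus_proj (G y) = k (torus_proj y)"
    and der: "\<And>y. y \<in> W \<Longrightarrow> (G has_derivative L y) (at y)"
    and cont: "\<And>v. continuous_on W (\<lambda>y. L y v)"
  shows "C1_torus_on (torus_proj ` W) k"
proof -
  let ?s = "inv_into W torus_proj"
  have d: "has_torus_derivative k (L y) (torus_proj y)" if "y \<in> W" for y
    using W(1) that lift der[OF that] by (rule has_torus_derivative_lift)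
  have hom: "homeomorphism W (torus_proj ` W) torus_proj ?s"
    by (rule homeomorphism_torus_proj[OF W])
  have "continuous_on (torus_proj ` W) (\<lambda>p. torus_deriv k p v)" for v
  proof -
    have "continuous_on (torus_proj ` W) (\<lambda>p. L (?s p) v)"
      by (rule continuous_on_compose2[OF cont[of v] homeomorphism_cont2[OF hom]])
        (simp add: homeomorphism_image2[OF hom])
    moreover have "torus_deriv k p v = L (?s p) v" if "p \<in> torus_proj ` W" for p
      using torus_deriv_eq[OF d[OF inv_into_into[OF that]]] by (simp only: f_inv_into_f[OF that])
    ultimately show ?thesis by (metis (no_types, lifting) continuous_on_eq)
  qed
  then show ?thesis unfolding C1_torus_on_def using d by fast
qed

text \<open>A \<open>C\<^sup>1\<close> diffeomorphism of the plane that covers a torus map restricts, over small balls, to local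
  inverses of the torus map.\<close>

lemma C1_local_diffeo_lift:
  assumes lift: "\<And>y. torus_proj (G y) = k (torus_proj y)"
    and inv: "\<And>y. H (G y) = y" "\<And>y. G (H y) = y"
    and der: "\<And>y. (G has_derivative L y) (at y)" "\<And>y. (H has_derivative M y) (at y)"
    and cont: "\<And>v. continuous_on UNIV (\<lambda>y. L y v)" "\<And>v. continuous_on UNIV (\<lambda>y. M y v)"
  shows "C1_local_diffeo k"
  unfolding C1_local_diffeo_def
proof
  fix p
  obtain x where p: "p = torus_proj x" by (rule torus_proj_cases)
  have contG: "continuous_on UNIV G" by (rule has_derivative_continuous_on) (rule der(1))
  have contH: "continuous_on UNIV H" by (rule has_derivative_continuous_on) (rule der(2))
  define W where "W = ball x (1/2) \<inter> G -` ball (G x) (1/2)"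
  have openW: "open W" unfolding W_def
    by (intro open_Int open_vimage[OF _ contG]) auto
  have GW: "G ` W = H -` W"
  proof (intro set_eqI iffI)
    fix y assume "y \<in> H -` W"
    then show "y \<in> G ` W" using inv(2)[of y] by (metis imageI vimageD)
  qed (auto simp: inv)
  have openGW: "open (G ` W)"
    unfolding GW by (rule open_vimage[OF openW contH])
  have injW: "inj_on torus_proj W"
    by (rule inj_on_subset[OF inj_on_torus_proj_ball[of x]]) (auto simp: W_def)
  have injGW: "inj_on torus_proj (G ` W)"
    by (rule inj_on_subset[OF inj_on_torus_proj_ball[of "G x"]]) (auto simp: W_def)
  let ?s = "inv_into W torus_proj" and ?t = "inv_into (G ` W) torus_proj"
  define h where "h = torus_proj \<circ> H \<circ> ?t"
  have homG: "homeomorphism W (G ` W) G H"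
    unfolding homeomorphism_def image_image inv
    using continuous_on_subset[OF contG] continuous_on_subset[OF contH] by (simp add: inv)
  have "homeomorphism (torus_proj ` W) (torus_proj ` G ` W) ((torus_proj \<circ> G) \<circ> ?s) (torus_proj \<circ> (H \<circ> ?t))"
    by (rule homeomorphism_compose[OF homeomorphism_symD[OF homeomorphism_torus_proj[OF openW injW]]
          homeomorphism_compose[OF homG homeomorphism_torus_proj[OF openGW injGW]]])
  then have hom: "homeomorphism (torus_proj ` W) (torus_proj ` G ` W) k h"
  proof (rule homeomorphism_cong)
    fix q assume "q \<in> torus_proj ` W"
    then show "k q = ((torus_proj \<circ> G) \<circ> ?s) q"
      by (simp add: lift f_inv_into_f)
  qed (simp_all add: h_def o_assoc)
  have C1k: "C1_torus_on (torus_proj ` W) k"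
    by (rule C1_torus_on_lift[OF openW injW lift der(1) continuous_on_subset[OF cont(1) subset_UNIV]])
  have "h (torus_proj y) = torus_proj (H y)" if "y \<in> G ` W" for y
    using that injGW by (simp add: h_def)
  then have C1h: "C1_torus_on (torus_proj ` G ` W) h"
    by (intro C1_torus_on_lift[OF openGW injGW _ der(2) continuous_on_subset[OF cont(2) subset_UNIV]])
      simp
  have "x \<in> W" by (simp add: W_def)
  then show "\<exists>U V h. open U \<and> p \<in> U \<and> open V \<and> homeomorphism U V k h \<and> C1_torus_on U k \<and> C1_torus_on V h"
    by (intro exI[of _ "torus_proj ` W"] exI[of _ "torus_proj ` G ` W"] exI[of _ h] conjI
        open_torus_proj_image openW openGW hom C1k C1h) (simp add: p)
qed

section \<open>The circle map and the shear\<close>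

text \<open>The triangle wave with \<open>tent r = 2 * r\<close> for \<open>\<bar>r\<bar> \<le> 1/2\<close>, continued with sign changes. Written with
  arc sine it is visibly continuous and changes sign under \<open>y \<mapsto> y + 1\<close>.\<close>

definition tent :: "real \<Rightarrow> real" where
  "tent y = 2 / pi * arcsin (sin (pi * y))"

lemma continuous_on_tent [continuous_intros]:
  fixes h :: "'a::t2_space \<Rightarrow> real"
  shows "continuous_on A h \<Longrightarrow> continuous_on A (\<lambda>z. tent (h z))"
  unfolding tent_def by (intro continuous_intros) auto

lemma tent_plus_one: "tent (y + 1) = - tent y"
  unfolding tent_def by (simp add: distrib_left sin_add arcsin_minus)

lemma tent_minus: "tent (- y) = - tent y"
  unfolding tent_def by (simp add: arcsin_minus)

lemma tent_eq: "\<bar>r\<bar> \<le> 1/2 \<Longrightarrow> tent r = 2 * r"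
proof -
  assume r: "\<bar>r\<bar> \<le> 1/2"
  have "pi * \<bar>r\<bar> \<le> pi * (1/2)"
    using r by (intro mult_left_mono) auto
  then have "\<bar>pi * r\<bar> \<le> pi / 2" by (simp add: abs_mult)
  then have "arcsin (sin (pi * r)) = pi * r"
    by (intro arcsin_sin) linarith+
  then show ?thesis by (simp add: tent_def)
qed

text \<open>The shifted wave is the analogue of the cosine; the absolute values of the two waves add up to \<open>1\<close>.\<close>

lemma tent_shift_eq:
  assumes "\<bar>r\<bar> \<le> 1/2" shows "tent (r + 1/2) = 1 - 2 * \<bar>r\<bar>"
proof (cases "r \<ge> 0")
  case True
  have "tent (r + 1/2) = - tent (r - 1/2)"
    using tent_plus_one[of "r - 1/2"] by (simp add: algebra_simps)
  also have "tent (r - 1/2) = 2 * (r - 1/2)"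
    using True assms by (intro tent_eq) (auto simp: abs_le_iff)
  finally show ?thesis using True by simp
next
  case False
  then show ?thesis using assms by (subst tent_eq) (auto simp: abs_le_iff)
qed

text \<open>Used to extend the explicit formulas on \<open>[-1/2, 1/2]\<close> to identities on the whole line.\<close>

lemma periodic_from_fundamental_interval:
  assumes base: "\<And>r. \<bar>r\<bar> \<le> 1/2 \<Longrightarrow> P r" and step: "\<And>y::real. P (y + 1) \<longleftrightarrow> P y"
  shows "P y"
proof -
  have "P (r + of_int n) \<longleftrightarrow> P r" for r :: real and n :: int
  proof (induction n rule: int_induct[where k = 0])
    case (step1 i)
    then show ?case using step[of "r + of_int i"] by (simp add: algebra_simps)
  next
    case (step2 i)
    then show ?case using step[of "r + of_int (i - 1)"] by (simp add: algebra_simps)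
  qed simp
  moreover have "P (y - of_int (round y))"
    using of_int_round_abs_le[of y] by (intro base) (simp add: abs_minus_commute)
  ultimately show ?thesis
    by (metis diff_add_cancel)
qed

text \<open>The quantities \<open>a\<close> and \<open>b\<close> of the introduction, continued to the line like sine and cosine of
  \<open>pi * y\<close>; indeed \<open>sn\<^sup>2 + cn\<^sup>2 = 1\<close> below. The square root of a negative number is taken to be the
  negative of the root of its absolute value. Both functions change sign under \<open>y \<mapsto> y + 1\<close>, so only
  lines and double cones built from them, but not vectors, descend to the circle.\<close>

definition sn :: "real \<Rightarrow> real" where "sn y = sqrt (tent y)"
definition cn :: "real \<Rightarrow> real" where "cn y = sqrt (tent (y + 1/2))"

lemma continuous_on_sn [continuous_intros]:
  fixes h :: "'a::t2_space \<Rightarrow> real"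
  shows "continuous_on A h \<Longrightarrow> continuous_on A (\<lambda>z. sn (h z))"
  unfolding sn_def by (intro continuous_intros)

lemma continuous_on_cn [continuous_intros]:
  fixes h :: "'a::t2_space \<Rightarrow> real"
  shows "continuous_on A h \<Longrightarrow> continuous_on A (\<lambda>z. cn (h z))"
  unfolding cn_def by (intro continuous_intros)

lemma sn_plus_one: "sn (y + 1) = - sn y"
  unfolding sn_def by (simp add: tent_plus_one real_sqrt_minus)

lemma cn_plus_one: "cn (y + 1) = - cn y"
  using tent_plus_one[of "y + 1/2"] unfolding cn_def by (simp add: add_ac real_sqrt_minus)

lemma sn_minus: "sn (- y) = - sn y"
  unfolding sn_def by (simp add: tent_minus real_sqrt_minus)

lemma cn_minus: "cn (- y) = cn y"
  using tent_plus_one[of "- y - 1/2"] tent_minus[of "y + 1/2"]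
  unfolding cn_def by (simp add: algebra_simps)

lemma sn_eq: "\<bar>r\<bar> \<le> 1/2 \<Longrightarrow> sn r = sqrt (2 * r)"
  by (simp add: sn_def tent_eq)

lemma cn_eq: "\<bar>r\<bar> \<le> 1/2 \<Longrightarrow> cn r = sqrt (1 - 2 * \<bar>r\<bar>)"
  by (simp add: cn_def tent_shift_eq)

lemma sn_power2_eq: "\<bar>r\<bar> \<le> 1/2 \<Longrightarrow> (sn r)\<^sup>2 = 2 * \<bar>r\<bar>"
  by (simp add: sn_def tent_eq power2_eq_square real_sqrt_mult_self abs_mult)

lemma cn_power2_eq: "\<bar>r\<bar> \<le> 1/2 \<Longrightarrow> (cn r)\<^sup>2 = 1 - 2 * \<bar>r\<bar>"
  by (simp add: cn_eq)

lemma sn_cn_squared: "(sn y)\<^sup>2 + (cn y)\<^sup>2 = 1"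
  by (rule periodic_from_fundamental_interval)
    (auto simp: sn_power2_eq cn_power2_eq sn_plus_one cn_plus_one)

lemma cn_squared: "(cn y)\<^sup>2 = 1 - (sn y)\<^sup>2"
  using sn_cn_squared[of y] by simp

lemma sn_squared_le_1: "(sn y)\<^sup>2 \<le> 1"
  using cn_squared[of y] zero_le_power2[of "cn y"] by linarith

lemma sn_abs_le_1: "\<bar>sn y\<bar> \<le> 1"
  using sn_squared_le_1[of y] by (simp add: abs_square_le_1)

lemma sn_eq_0_iff: "sn y = 0 \<longleftrightarrow> y \<in> \<int>"
proof (rule periodic_from_fundamental_interval[where P = "\<lambda>y. sn y = 0 \<longleftrightarrow> y \<in> \<int>"])
  fix r :: real assume r: "\<bar>r\<bar> \<le> 1/2"
  then show "sn r = 0 \<longleftrightarrow> r \<in> \<int>"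
    using Ints_nonzero_abs_less1[of r] by (auto simp: sn_eq)
qed (auto simp: sn_plus_one)

text \<open>The two integrals cover arguments of either sign; at most one interval is nondegenerate.\<close>

definition antiderivative :: "(real \<Rightarrow> real) \<Rightarrow> real \<Rightarrow> real" where
  "antiderivative k y = integral {0..y} k - integral {y..0} k"

lemma antiderivative_0 [simp]: "antiderivative k 0 = 0"
  by (simp add: antiderivative_def)

lemma antiderivative_has_derivative:
  assumes "continuous_on UNIV k"
  shows "(antiderivative k has_real_derivative k y) (at y)"
proof -
  define M where "M = \<bar>y\<bar> + 1"
  have int: "k integrable_on {u..v}" for u v
    by (intro integrable_continuous_interval continuous_on_subset[OF assms]) auto
  have eq: "integral {- M..z} k - integral {- M..0} k = antiderivative k z" if "z \<in> {- M<..<M}" for z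
  proof (cases "z \<ge> 0")
    case True
    then show ?thesis
      using Henstock_Kurzweil_Integration.integral_combine[of "- M" 0 z k] int that
      by (cases "z = 0") (auto simp: antiderivative_def M_def)
  next
    case False
    then show ?thesis
      using Henstock_Kurzweil_Integration.integral_combine[of "- M" z 0 k] int that
      by (auto simp: antiderivative_def M_def)
  qed
  have "((\<lambda>z. integral {- M..z} k) has_real_derivative k y) (at y within {- M..M})"
    by (rule integral_has_real_derivative)
      (use continuous_on_subset[OF assms] in \<open>auto simp: M_def\<close>)
  then have "((\<lambda>z. integral {- M..z} k) has_real_derivative k y) (at y)"
    by (simp add: M_def at_within_Icc_at)
  then have "((\<lambda>z. integral {- M..z} k - integral {- M..0} k) has_real_derivative k y - 0) (at y)"
    by (intro derivative_intros)
  then have "((\<lambda>z. integral {- M..z} k - integral {- M..0} k) has_real_derivative k y) (at y)"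
    by simp
  then show ?thesis
    by (rule has_field_derivative_transform_within_open[where S = "{- M<..<M}"])
      (use eq in \<open>auto simp: M_def\<close>)
qed

text \<open>This is the derivative of the Moebius map \<open>y \<mapsto> 4 * y / (1 + 6 * y)\<close>, written in terms of
  \<open>(sn y)\<^sup>2 = 2 * y\<close>, and hence continued periodically and evenly. Defining the circle map as an
  antiderivative gives differentiability at the points \<open>0\<close> and \<open>1/2\<close>, where the Moebius pieces meet, for
  free.\<close>

definition dcirc :: "real \<Rightarrow> real" where
  "dcirc y = 4 / (1 + 3 * (sn y)\<^sup>2)\<^sup>2"
text \<open>This is \<open>c' (\<chi>' \<circ> c) - 2\<chi>'\<close> with \<open>\<chi>' = cn/sn\<close>, simplified: the factor \<open>1/sn\<close> of both terms has
  cancelled, which leaves a continuous function.\<close>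

definition dshear :: "real \<Rightarrow> real" where
  "dshear y = - 6 * sn y * cn y * (2 + 3 * (sn y)\<^sup>2) / (1 + 3 * (sn y)\<^sup>2)\<^sup>2"

lemma one_plus_sn_pos: "1 + 3 * (sn y)\<^sup>2 > 0"
  by (simp add: add_pos_nonneg)

lemma one_plus_sn_nonzero [simp]: "1 + 3 * (sn y)\<^sup>2 \<noteq> 0"
  using one_plus_sn_pos[of y] by linarith

lemma continuous_on_dcirc [continuous_intros]:
  fixes h :: "'a::t2_space \<Rightarrow> real"
  shows "continuous_on A h \<Longrightarrow> continuous_on A (\<lambda>z. dcirc (h z))"
  unfolding dcirc_def by (intro continuous_intros) auto

lemma continuous_on_dshear [continuous_intros]:
  fixes h :: "'a::t2_space \<Rightarrow> real"
  shows "continuous_on A h \<Longrightarrow> continuous_on A (\<lambda>z. dshear (h z))"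
  unfolding dshear_def by (intro continuous_intros) auto

lemma dcirc_pos: "dcirc y > 0"
  unfolding dcirc_def by (intro divide_pos_pos zero_less_power one_plus_sn_pos) auto

text \<open>A lift of the circle diffeomorphism.\<close>

definition circ :: "real \<Rightarrow> real" where "circ = antiderivative dcirc"
definition shear :: "real \<Rightarrow> real" where "shear = antiderivative dshear"

lemma circ_deriv: "(circ has_real_derivative dcirc y) (at y)"
  unfolding circ_def by (intro antiderivative_has_derivative continuous_intros)

lemma shear_deriv: "(shear has_real_derivative dshear y) (at y)"
  unfolding shear_def by (intro antiderivative_has_derivative continuous_intros)

lemma circ_0 [simp]: "circ 0 = 0" by (simp add: circ_def)
lemma shear_0 [simp]: "shear 0 = 0" by (simp add: shear_def)

lemma circ_deriv_comp [derivative_intros]: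
  "(h has_real_derivative h') (at y) \<Longrightarrow> ((\<lambda>z. circ (h z)) has_real_derivative dcirc (h y) * h') (at y)"
  using DERIV_chain2[OF circ_deriv] .

lemma shear_deriv_comp [derivative_intros]:
  "(h has_real_derivative h') (at y) \<Longrightarrow> ((\<lambda>z. shear (h z)) has_real_derivative dshear (h y) * h') (at y)"
  using DERIV_chain2[OF shear_deriv] .

lemma circ_minus: "circ (- y) = - circ y"
proof -
  have "((\<lambda>y. circ y + circ (- y)) has_real_derivative 0) (at z)" for z
    by (rule derivative_eq_intros refl)+ (simp add: dcirc_def sn_minus)
  then have "circ y + circ (- y) = circ 0 + circ (- 0)"
    using DERIV_isconst_all by blast
  then show ?thesis by simp
qed

lemma shear_minus: "shear (- y) = shear y"
proof -
  have "((\<lambda>y. shear y - shear (- y)) has_real_derivative 0) (at z)" for z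
    by (rule derivative_eq_intros refl)+ (simp add: dshear_def sn_minus cn_minus)
  then have "shear y - shear (- y) = shear 0 - shear (- 0)"
    using DERIV_isconst_all by blast
  then show ?thesis by simp
qed

text \<open>Both sides have the same derivative on the interval and agree at \<open>0\<close>.\<close>

lemma circ_eq_nonneg:
  assumes "0 \<le> r" "r \<le> 1/2" shows "circ r = 4 * r / (1 + 6 * r)"
proof -
  have "((\<lambda>y. circ y - 4 * y / (1 + 6 * y)) has_real_derivative 0) (at y within {0..1/2})"
    if "y \<in> {0..1/2}" for y
  proof -
    have dcirc: "dcirc y = 4 / (1 + 6 * y)\<^sup>2"
      using that by (simp add: dcirc_def sn_power2_eq)
    have "((\<lambda>y. circ y - 4 * y / (1 + 6 * y)) has_real_derivative 0) (at y)"
      using that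
      by (auto intro!: derivative_eq_intros simp: dcirc field_simps power2_eq_square)
    then show ?thesis by (rule has_field_derivative_at_within)
  qed
  then have "\<exists>c. \<forall>y\<in>{0..1/2}. circ y - 4 * y / (1 + 6 * y) = c"
    by (intro has_field_derivative_zero_constant) auto
  then obtain c where c: "\<And>y. y \<in> {0..1/2} \<Longrightarrow> circ y - 4 * y / (1 + 6 * y) = c"
    by blast
  from c[of 0] c[of r] assms show ?thesis by simp
qed

lemma circ_eq:
  assumes "\<bar>r\<bar> \<le> 1/2" shows "circ r = 4 * r / (1 + 6 * \<bar>r\<bar>)"
proof (cases "r \<ge> 0")
  case False
  then show ?thesis using circ_eq_nonneg[of "- r"] circ_minus[of r] assms by (simp add: abs_if)
qed (use assms circ_eq_nonneg in auto)

text \<open>The difference is constant, and it is evaluated at \<open>-1/2\<close>, where the explicit formula applies to both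
  ends of the fundamental interval.\<close>

lemma circ_plus_one: "circ (y + 1) = circ y + 1"
proof -
  have "((\<lambda>y. circ (y + 1) - circ y) has_real_derivative 0) (at z)" for z
    by (rule derivative_eq_intros refl)+ (simp add: dcirc_def sn_plus_one)
  then have "circ (y + 1) - circ y = circ (- (1/2) + 1) - circ (- (1/2))"
    using DERIV_isconst_all by blast
  then show ?thesis by (simp add: circ_minus circ_eq)
qed

text \<open>The shear descends to the circle because its derivative is odd, so that it has mean value zero.\<close>

lemma shear_plus_one: "shear (y + 1) = shear y"
proof -
  have "((\<lambda>y. shear (y + 1) - shear y) has_real_derivative 0) (at z)" for z
    by (rule derivative_eq_intros refl)+ (simp add: dshear_def sn_plus_one cn_plus_one)
  then have "shear (y + 1) - shear y = shear (- (1/2) + 1) - shear (- (1/2))"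
    using DERIV_isconst_all by blast
  then show ?thesis by (simp add: shear_minus)
qed

definition damp :: "real \<Rightarrow> real" where "damp y = sqrt (1 + 3 * (sn y)\<^sup>2)"

lemma damp_power2: "(damp y)\<^sup>2 = 1 + 3 * (sn y)\<^sup>2"
  unfolding damp_def using one_plus_sn_pos[of y] by simp

lemma damp_bounds: "1 \<le> damp y" "damp y \<le> 2"
proof -
  show "1 \<le> damp y" by (simp add: damp_def)
  have "damp y \<le> sqrt 4" unfolding damp_def using sn_squared_le_1[of y] by (intro real_sqrt_le_mono) auto
  then show "damp y \<le> 2" by simp
qed

text \<open>In the coordinate \<open>sn/cn\<close> the circle map is multiplication by \<open>2\<close>; with the normalisation
  \<open>sn\<^sup>2 + cn\<^sup>2 = 1\<close> this introduces the denominator \<open>damp\<close>.\<close>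

lemma sn_circ: "sn (circ y) = 2 * sn y / damp y"
proof (rule periodic_from_fundamental_interval[where P = "\<lambda>y. sn (circ y) = 2 * sn y / damp y"])
  fix r :: real assume r: "\<bar>r\<bar> \<le> 1/2"
  then have "\<bar>circ r\<bar> \<le> 1/2" by (auto simp: circ_eq abs_mult divide_simps)
  then have "sn (circ r) = sqrt (2 * 2 * (2 * r) / (1 + 6 * \<bar>r\<bar>))"
    using r by (simp add: sn_eq circ_eq)
  also have "\<dots> = sqrt (2 * 2) * sqrt (2 * r) / sqrt (1 + 6 * \<bar>r\<bar>)"
    by (simp only: real_sqrt_mult real_sqrt_divide)
  also have "\<dots> = 2 * sn r / damp r"
    using r by (simp add: damp_def sn_power2_eq) (simp add: sn_eq)
  finally show "sn (circ r) = 2 * sn r / damp r" .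
qed (simp add: sn_plus_one circ_plus_one damp_def)

lemma cn_circ: "cn (circ y) = cn y / damp y"
proof (rule periodic_from_fundamental_interval[where P = "\<lambda>y. cn (circ y) = cn y / damp y"])
  fix r :: real assume r: "\<bar>r\<bar> \<le> 1/2"
  then have "\<bar>circ r\<bar> \<le> 1/2" by (auto simp: circ_eq abs_mult divide_simps)
  then have "cn (circ r) = sqrt ((1 - 2 * \<bar>r\<bar>) / (1 + 6 * \<bar>r\<bar>))"
    using r by (simp add: cn_eq circ_eq abs_mult divide_simps)
  also have "\<dots> = cn r / damp r"
    using r by (simp add: cn_eq damp_def sn_power2_eq real_sqrt_divide)
  finally show "cn (circ r) = cn r / damp r" .
qed (simp add: cn_plus_one sn_plus_one circ_plus_one damp_def)

section \<open>The endomorphism and its invariant frame\<close>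

definition lift :: "real^2 \<Rightarrow> real^2" where
  "lift v = vector [2 * v $ 1 + shear (v $ 2), circ (v $ 2)]"

definition dlift :: "real \<Rightarrow> real^2 \<Rightarrow> real^2" where
  "dlift y v = vector [2 * v $ 1 + dshear y * v $ 2, dcirc y * v $ 2]"

definition endo :: "torus \<Rightarrow> torus" where
  "endo p = torus_proj (lift (rep_torus p))"

lemma has_derivative_real_comp:
  fixes k :: "real \<Rightarrow> real"
  assumes "(k has_real_derivative k') (at (p x))" "(p has_derivative p') (at x)"
  shows "((\<lambda>z. k (p z)) has_derivative (\<lambda>h. k' * p' h)) (at x)"
  using has_derivative_compose[OF assms(2) assms(1)[unfolded has_field_derivative_def]] .

lemma lift_has_derivative: "(lift has_derivative dlift (x $ 2)) (at x)"
proof -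
  have nth: "((\<lambda>z. z $ i) has_derivative (\<lambda>h. h $ i)) (at x)" for i
    by (intro derivative_intros)
  have "((\<lambda>v. vector [2 * v $ 1 + shear (v $ 2), circ (v $ 2)] :: real^2) has_derivative
      (\<lambda>v. vector [2 * v $ 1 + dshear (x $ 2) * v $ 2, dcirc (x $ 2) * v $ 2])) (at x)"
    by (intro has_derivative_vector2 has_derivative_add has_derivative_mult_right nth
        has_derivative_real_comp[OF shear_deriv nth] has_derivative_real_comp[OF circ_deriv nth])
  then show ?thesis unfolding lift_def dlift_def .
qed

lemma linear_dlift: "linear (dlift y)"
  by (rule linearI) (auto simp: dlift_def vector2_eq_iff algebra_simps)

lemma plus_int:
  fixes k :: "real \<Rightarrow> real"
  assumes "\<And>y. k (y + 1) = k y + c"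
  shows "k (y + of_int n) = k y + of_int n * c"
proof (induction n rule: int_induct[where k = 0])
  case (step1 i)
  then show ?case using assms[of "y + of_int i"] by (simp add: algebra_simps)
next
  case (step2 i)
  then show ?case using assms[of "y + of_int (i - 1)"] by (simp add: algebra_simps)
qed simp

lemma circ_plus_int: "circ (y + of_int n) = circ y + of_int n"
  using plus_int[of circ 1 y n] circ_plus_one by simp

lemma shear_plus_int: "shear (y + of_int n) = shear y"
  using plus_int[of shear 0 y n] shear_plus_one by simp

text \<open>Horizontally the lift has degree \<open>2\<close>, vertically degree \<open>1\<close>.\<close>

lemma lift_congruent:
  assumes "torus_proj x = torus_proj x'"
  shows "torus_proj (lift x) = torus_proj (lift x')"
proof -
  obtain m n where x: "x $ 1 = x' $ 1 + of_int m" "x $ 2 = x' $ 2 + of_int n"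
    using assms by (rule torus_proj_eqE)
  have "lift x $ 1 - lift x' $ 1 = of_int (2 * m)" "lift x $ 2 - lift x' $ 2 = of_int n"
    unfolding lift_def x circ_plus_int shear_plus_int by simp_all
  then show ?thesis
    unfolding torus_proj_eq_iff forall_2 by (metis Ints_of_int)
qed

lemma endo_torus_proj: "endo (torus_proj x) = torus_proj (lift x)"
  unfolding endo_def by (rule lift_congruent) simp

lemma torus_deriv_endo:
  "has_torus_derivative endo (dlift (x $ 2)) (torus_proj x)"
  "torus_deriv endo (torus_proj x) = dlift (x $ 2)"
proof -
  show "has_torus_derivative endo (dlift (x $ 2)) (torus_proj x)"
    by (rule has_torus_derivative_lift[OF open_UNIV _ _ lift_has_derivative])
      (simp_all add: endo_torus_proj)
  then show "torus_deriv endo (torus_proj x) = dlift (x $ 2)"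
    by (rule torus_deriv_eq)
qed

lemma strict_mono_circ: "strict_mono circ"
  by (rule strict_monoI) (meson DERIV_pos_imp_increasing dcirc_pos circ_deriv)

text \<open>Integers are fixed, so the intermediate value theorem applies between consecutive integers.\<close>

lemma surj_circ: "surj circ"
proof -
  have "\<exists>x. circ x = y" for y
  proof -
    have "circ (of_int n) = of_int n" for n
      using circ_plus_int[of 0 n] by simp
    then have "circ (of_int \<lfloor>y\<rfloor>) \<le> y" "y \<le> circ (of_int (\<lfloor>y\<rfloor> + 1))"
      by (simp_all only:) linarith+
    then show ?thesis
      using IVT[of circ "of_int \<lfloor>y\<rfloor>" y "of_int (\<lfloor>y\<rfloor> + 1)"] DERIV_isCont[OF circ_deriv] by auto
  qed
  then show ?thesis by (metis surjI)
qed

definition circ_inv :: "real \<Rightarrow> real" where "circ_inv = inv circ"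

lemma circ_inv_circ [simp]: "circ_inv (circ y) = y"
  unfolding circ_inv_def by (simp add: strict_mono_circ strict_mono_imp_inj_on)

lemma circ_circ_inv [simp]: "circ (circ_inv y) = y"
  unfolding circ_inv_def by (simp add: surj_f_inv_f surj_circ)

lemma circ_inv_deriv: "(circ_inv has_real_derivative inverse (dcirc (circ_inv y))) (at y)"
proof -
  have "isCont circ_inv (circ (circ_inv y))"
    by (rule isCont_inverse_function[where d = 1]) (auto intro: DERIV_isCont[OF circ_deriv])
  then have "isCont circ_inv y" by simp
  then show ?thesis
    using dcirc_pos[of "circ_inv y"]
    by (intro DERIV_inverse_function[OF circ_deriv, where a = "y - 1" and b = "y + 1"]) auto
qed

lemma continuous_on_circ_inv: "continuous_on A circ_inv"
  using DERIV_isCont[OF circ_inv_deriv] by (simp add: continuous_at_imp_continuous_on)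

lemma endo_C1_local_diffeo: "C1_local_diffeo endo"
proof (rule C1_local_diffeo_lift)
  define H :: "real^2 \<Rightarrow> real^2" where
    "H v = vector [(v $ 1 - shear (circ_inv (v $ 2))) * (1/2), circ_inv (v $ 2)]" for v
  define M :: "real^2 \<Rightarrow> real^2 \<Rightarrow> real^2" where
    "M x v = (let y = circ_inv (x $ 2) in
        vector [(v $ 1 - dshear y * (inverse (dcirc y) * v $ 2)) * (1/2), inverse (dcirc y) * v $ 2])" for x v
  show "torus_proj (lift y) = endo (torus_proj y)" for y by (simp add: endo_torus_proj)
  show "H (lift y) = y" "lift (H y) = y" for y by (simp_all add: H_def lift_def vector2_eq_iff field_simps)
  show "(lift has_derivative dlift (y $ 2)) (at y)" for y by (rule lift_has_derivative)
  show "(H has_derivative M y) (at y)" for y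
  proof -
    have nth: "((\<lambda>z. z $ i) has_derivative (\<lambda>h. h $ i)) (at y)" for i
      by (intro derivative_intros)
    show ?thesis unfolding H_def[abs_def] M_def Let_def
      by (intro has_derivative_vector2 has_derivative_diff has_derivative_mult_left nth
        has_derivative_real_comp[OF shear_deriv] has_derivative_real_comp[OF circ_inv_deriv nth])
  qed
  show "continuous_on UNIV (\<lambda>y. dlift (y $ 2) v)" for v
    unfolding dlift_def by (intro continuous_intros)
  have "continuous_on UNIV (\<lambda>x::real^2. circ_inv (x $ 2))"
    by (rule continuous_on_compose2[OF continuous_on_circ_inv[of UNIV]]) (auto intro: continuous_intros)
  then show "continuous_on UNIV (\<lambda>y. M y v)" for v
    unfolding M_def Let_def using dcirc_pos
    by (intro continuous_intros) (auto simp: less_imp_neq[symmetric])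
qed

definition wedge :: "real^2 \<Rightarrow> real^2 \<Rightarrow> real" where
  "wedge v w = v $ 1 * w $ 2 - v $ 2 * w $ 1"

text \<open>The frame that diagonalises the derivative. The centre vector \<open>(cn, sn)\<close> is proportional to
  \<open>(\<chi>', 1)\<close>, the tangent of the prescribed centre curves. The other vector is
  \<open>((1, 0) - cn^3 * cent) / sn\<close>, in which the denominator cancels. Where \<open>sn\<close> does not vanish, both
  \<open>(1, 0)\<close> and \<open>cn^3 * cent\<close> are mapped to twice their counterparts at the image point, which makes
  the combination an eigenvector.\<close>

definition unst :: "real \<Rightarrow> real^2" where
  "unst y = vector [sn y * (1 + (cn y)\<^sup>2), - ((cn y)^3)]"

definition cent :: "real \<Rightarrow> real^2" where
  "cent y = vector [cn y, sn y]"

lemma wedge_frame: "wedge (unst y) (cent y) = 1"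
proof -
  have "wedge (unst y) (cent y) = (sn y)\<^sup>2 + (cn y)\<^sup>2 * ((sn y)\<^sup>2 + (cn y)\<^sup>2)"
    by (simp add: wedge_def unst_def cent_def) algebra
  then show ?thesis by (simp add: sn_cn_squared)
qed

text \<open>Cramer's rule for a basis of determinant \<open>1\<close>.\<close>

lemma frame_expansion: "v = wedge v (cent y) *\<^sub>R unst y + wedge (unst y) v *\<^sub>R cent y"
proof -
  have 1: "unst y $ 1 * cent y $ 2 - unst y $ 2 * cent y $ 1 = 1"
    using wedge_frame[of y] by (simp add: wedge_def)
  show ?thesis
    unfolding vector2_eq_iff using 1 by (simp add: wedge_def) algebra
qed

lemma dshear_eq: "dshear y * (1 + 3 * (sn y)\<^sup>2)\<^sup>2 = - 6 * sn y * cn y * (2 + 3 * (sn y)\<^sup>2)"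
  by (simp add: dshear_def)

text \<open>The vector \<open>cn^3 * cent\<close> is doubled, and \<open>cn\<close> is divided by \<open>damp\<close>. The coefficient exceeds \<open>1\<close> near
  the circle \<open>y = 0\<close> and is \<open>1/4\<close> on the circle \<open>y = 1/2\<close>.\<close>

lemma dlift_cent: "dlift y (cent y) = (2 / (damp y)^3) *\<^sub>R cent (circ y)"
proof -
  let ?a = "sn y" and ?b = "cn y" and ?d = "damp y"
  have d: "?d \<noteq> 0" using damp_bounds[of y] by auto
  have dsq: "1 + 3 * ?a\<^sup>2 = ?d\<^sup>2" by (simp add: damp_power2)
  have "2 * ?b + dshear y * ?a = 2 / ?d^3 * (?b / ?d)"
  proof -
    have "(2 * ?b + dshear y * ?a) * (1 + 3 * ?a\<^sup>2)\<^sup>2 = 2 * ?b"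
      using dshear_eq[of y] by algebra
    then show ?thesis unfolding dsq using d by (simp add: field_simps power_mult[symmetric] eval_nat_numeral)
  qed
  moreover have "dcirc y * ?a = 2 / ?d^3 * (2 * ?a / ?d)"
    unfolding dcirc_def dsq using d by (simp add: field_simps eval_nat_numeral)
  ultimately show ?thesis
    by (simp add: dlift_def cent_def vector2_eq_iff sn_circ cn_circ)
qed

text \<open>The vector \<open>sn * unst\<close> is doubled, and \<open>sn\<close> is multiplied by \<open>2 / damp\<close>.\<close>

lemma dlift_unst: "dlift y (unst y) = (4 / damp y) *\<^sub>R unst (circ y)"
proof -
  let ?a = "sn y" and ?b = "cn y" and ?d = "damp y"
  have d: "?d \<noteq> 0" using damp_bounds[of y] by auto
  have dsq: "1 + 3 * ?a\<^sup>2 = ?d\<^sup>2" by (simp add: damp_power2)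
  have b: "?b\<^sup>2 = 1 - ?a\<^sup>2" by (rule cn_squared)
  have "2 * (?a * (1 + ?b\<^sup>2)) + dshear y * - (?b^3) = 4 / ?d * (2 * ?a / ?d * (1 + (?b / ?d)\<^sup>2))"
  proof -
    have "(2 * (?a * (1 + ?b\<^sup>2)) + dshear y * - (?b^3)) * (1 + 3 * ?a\<^sup>2)\<^sup>2
        = 2 * ?a * (1 + ?b\<^sup>2) * (1 + 3 * ?a\<^sup>2)\<^sup>2 + 6 * ?a * (?b\<^sup>2)\<^sup>2 * (2 + 3 * ?a\<^sup>2)"
      using dshear_eq[of y] by algebra
    also have "\<dots> = 8 * ?a * ((1 + 3 * ?a\<^sup>2) + ?b\<^sup>2)"
      unfolding b by algebra
    finally show ?thesis unfolding dsq using d by (simp add: field_simps eval_nat_numeral)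
  qed
  moreover have "dcirc y * - (?b^3) = 4 / ?d * - ((?b / ?d)^3)"
    unfolding dcirc_def dsq using d by (simp add: field_simps eval_nat_numeral)
  ultimately show ?thesis
    by (simp add: dlift_def unst_def vector2_eq_iff sn_circ cn_circ)
qed

section \<open>Double sectors\<close>

definition dir :: "real \<Rightarrow> real^2" where "dir t = vector [cos t, sin t]"

lemma wedge_dir: "wedge (dir a) (dir b) = sin (b - a)"
  by (simp add: wedge_def dir_def sin_diff)

lemma wedge_scaleR [simp]:
  "wedge (r *\<^sub>R v) w = r * wedge v w" "wedge v (r *\<^sub>R w) = r * wedge v w"
  by (simp_all add: wedge_def algebra_simps)

lemma wedge_add: "wedge (u + v) w = wedge u w + wedge v w" "wedge w (u + v) = wedge w u + wedge w v"
  and wedge_diff: "wedge (u - v) w = wedge u w - wedge v w" "wedge w (u - v) = wedge w u - wedge w v"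
  and wedge_minus [simp]: "wedge (- u) w = - wedge u w" "wedge w (- u) = - wedge w u"
  and wedge_0 [simp]: "wedge 0 w = 0" "wedge w 0 = 0"
  by (simp_all add: wedge_def algebra_simps)

lemma wedge_self [simp]: "wedge v v = 0"
  by (simp add: wedge_def)

lemma wedge_commute: "wedge v w = - wedge w v"
  by (simp add: wedge_def)

lemma continuous_on_wedge [continuous_intros]:
  "continuous_on A p \<Longrightarrow> continuous_on A q \<Longrightarrow> continuous_on A (\<lambda>z. wedge (p z) (q z))"
  unfolding wedge_def by (intro continuous_intros)

lemma inner_wedge_squared: "(v \<bullet> w)\<^sup>2 + (wedge v w)\<^sup>2 = (v \<bullet> v) * (w \<bullet> w)"
  by (simp add: inner_vec_def sum_2 wedge_def) algebra

lemma inner_dir [simp]: "dir t \<bullet> dir t = 1"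
  by (simp add: dir_def inner_vec_def sum_2 flip: power2_eq_square)

lemma dir_expansion: "v = (v \<bullet> dir a) *\<^sub>R dir a + wedge (dir a) v *\<^sub>R dir (a + pi / 2)"
proof -
  have sc: "cos a * cos a + sin a * sin a = 1"
    using sin_cos_squared_add2[of a] by (simp add: power2_eq_square)
  have "x = (x * cos a + y * sin a) * cos a - (cos a * y - sin a * x) * sin a" for x y
    using sc by algebra
  moreover have "y = (x * cos a + y * sin a) * sin a + (cos a * y - sin a * x) * cos a" for x y
    using sc by algebra
  ultimately show ?thesis
    unfolding vector2_eq_iff
    by (simp add: dir_def inner_vec_def sum_2 wedge_def sin_add cos_add)
qed

lemma dir_add: "dir (a + s) = cos s *\<^sub>R dir a + sin s *\<^sub>R dir (a + pi / 2)"
  by (simp add: vector2_eq_iff dir_def sin_add cos_add algebra_simps)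

lemma sector_memI: "0 \<le> r \<Longrightarrow> a \<le> t \<Longrightarrow> t \<le> b \<Longrightarrow> r *\<^sub>R dir t \<in> sector a b"
  unfolding sector_def dir_def by blast

text \<open>In polar coordinates around the direction \<open>a\<close> the first inequality bounds the angle by \<open>pi\<close>; then the
  second one bounds it by \<open>b - a\<close>.\<close>

lemma in_sectorI:
  assumes "a < b" "b - a < pi" "wedge (dir a) v \<ge> 0" "wedge v (dir b) \<ge> 0"
  shows "v \<in> sector a b"
proof (cases "v = 0")
  case True
  then show ?thesis using assms(1) sector_memI[of 0 a a b] by simp
next
  case False
  define r where "r = norm v"
  have r: "r > 0" using False by (simp add: r_def)
  have "(v \<bullet> dir a)\<^sup>2 + (wedge (dir a) v)\<^sup>2 = r\<^sup>2"
    using inner_wedge_squared[of v "dir a"] wedge_commute[of v "dir a"]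
    by (simp add: r_def power2_norm_eq_inner)
  then have "(v \<bullet> dir a / r)\<^sup>2 + (wedge (dir a) v / r)\<^sup>2 = 1"
    using r by (simp add: power_divide flip: add_divide_distrib)
  moreover have "wedge (dir a) v / r \<ge> 0" using assms(3) r by simp
  ultimately obtain s where s: "0 \<le> s" "s \<le> pi" "v \<bullet> dir a / r = cos s" "wedge (dir a) v / r = sin s"
    using sincos_total_pi by metis
  have coeff: "v \<bullet> dir a = r * cos s" "wedge (dir a) v = r * sin s"
    using s(3,4) r by (simp_all add: field_simps)
  have "v = (r * cos s) *\<^sub>R dir a + (r * sin s) *\<^sub>R dir (a + pi / 2)"
    using dir_expansion[of v a] unfolding coeff .
  then have v: "v = r *\<^sub>R dir (a + s)"
    unfolding dir_add[of a s] by (simp add: scaleR_add_right)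
  have "s \<le> b - a"
  proof (rule ccontr)
    assume "\<not> s \<le> b - a"
    then have "sin (s - (b - a)) > 0" using s assms(1,2) by (intro sin_gt_zero) auto
    moreover have "sin (b - (a + s)) \<ge> 0"
      using assms(4) r by (simp add: v wedge_dir zero_le_mult_iff)
    moreover have "s - (b - a) = - (b - (a + s))" by simp
    ultimately show False by (simp only: sin_minus)
  qed
  then show ?thesis
    using s(1) r sector_memI[of r a "a + s" b] by (simp add: v)
qed

lemma sector_wedge_nonneg:
  assumes "b - a < pi" "v \<in> sector a b"
  shows "wedge (dir a) v \<ge> 0 \<and> wedge v (dir b) \<ge> 0"
proof -
  obtain r t where t: "0 \<le> r" "a \<le> t" "t \<le> b" and v: "v = r *\<^sub>R dir t"
    using assms(2) unfolding sector_def dir_def by blast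
  have "sin (t - a) \<ge> 0" "sin (b - t) \<ge> 0"
    using t assms(1) by (auto intro!: sin_ge_zero)
  then show ?thesis
    using t(1) unfolding v wedge_scaleR wedge_dir by (intro conjI mult_nonneg_nonneg)
qed

text \<open>Double sectors are the solution sets of a quadratic inequality. This replaces angles by
  determinants, which are polynomial in the edge vectors.\<close>

lemma double_sector_iff:
  assumes "0 < b - a" "b - a < pi"
  shows "v \<in> sector a b \<union> uminus ` sector a b \<longleftrightarrow> wedge (dir a) v * wedge v (dir b) \<ge> 0"
    (is "_ \<longleftrightarrow> ?p * ?q \<ge> 0")
proof -
  have "v \<in> sector a b \<longleftrightarrow> ?p \<ge> 0 \<and> ?q \<ge> 0"
    using sector_wedge_nonneg[OF assms(2), of v] in_sectorI[of a b v] assms by auto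
  moreover have "v \<in> uminus ` sector a b \<longleftrightarrow> - v \<in> sector a b"
    by (metis image_iff minus_minus)
  moreover have "- v \<in> sector a b \<longleftrightarrow> ?p \<le> 0 \<and> ?q \<le> 0"
    using sector_wedge_nonneg[OF assms(2), of "- v"] in_sectorI[of a b "- v"] assms
    unfolding wedge_minus neg_0_le_iff_le by auto
  ultimately show ?thesis unfolding zero_le_mult_iff Un_iff by argo
qed

text \<open>In the half plane around the direction \<open>c\<close> the arc tangent is a continuous branch of the angle.\<close>

lemma polar_angle:
  assumes "e \<bullet> dir c > 0"
  shows "\<exists>k>0. e = k *\<^sub>R dir (c + arctan (wedge (dir c) e / (e \<bullet> dir c)))"
proof -
  define m where "m = e \<bullet> dir c"
  define x where "x = wedge (dir c) e / m"
  define q where "q = sqrt (1 + x\<^sup>2)"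
  have q: "q > 0" by (simp add: q_def add_pos_nonneg)
  have m: "m > 0" using assms by (simp add: m_def)
  have "(m * q) *\<^sub>R dir (c + arctan x) = m *\<^sub>R dir c + (m * x) *\<^sub>R dir (c + pi / 2)"
    unfolding dir_add[of c "arctan x"] cos_arctan sin_arctan q_def[symmetric]
    using q by (simp add: scaleR_add_right)
  also have "m * x = wedge (dir c) e" using m by (simp add: x_def)
  also have "m *\<^sub>R dir c + wedge (dir c) e *\<^sub>R dir (c + pi / 2) = e"
    unfolding m_def by (rule dir_expansion[symmetric])
  finally have "e = (m * q) *\<^sub>R dir (c + arctan x)" ..
  moreover have "m * q > 0" using m q by simp
  ultimately show ?thesis unfolding x_def m_def by (intro exI conjI)
qed

text \<open>Only continuity of edge vectors has to be known. Angles exist locally, measured from a fixed direction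
  \<open>c\<close> that lies within a right angle of both edges at the point in question.\<close>

lemma cone_family_from_edges:
  assumes "\<And>p. \<exists>U e1 e2 c. open U \<and> p \<in> U \<and> continuous_on U e1 \<and> continuous_on U e2 \<and>
      e1 p \<bullet> dir c > 0 \<and> e2 p \<bullet> dir c > 0 \<and>
      (\<forall>q\<in>U. wedge (e1 q) (e2 q) > 0 \<and> C q = {v. wedge (e1 q) v * wedge v (e2 q) \<ge> 0})"
  shows "cone_family C"
  unfolding cone_family_def
proof
  fix p
  obtain U0 e1 e2 c where U0: "open U0" "p \<in> U0" and e: "continuous_on U0 e1" "continuous_on U0 e2"
    and ec: "e1 p \<bullet> dir c > 0" "e2 p \<bullet> dir c > 0"
    and w: "\<And>q. q \<in> U0 \<Longrightarrow> wedge (e1 q) (e2 q) > 0"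
    and C: "\<And>q. q \<in> U0 \<Longrightarrow> C q = {v. wedge (e1 q) v * wedge v (e2 q) \<ge> 0}"
    using assms[of p] by blast
  define U where "U = ((\<lambda>q. e1 q \<bullet> dir c) -` {0<..} \<inter> U0) \<inter> ((\<lambda>q. e2 q \<bullet> dir c) -` {0<..} \<inter> U0)"
  have "open ((\<lambda>q. e q \<bullet> dir c) -` {0<..} \<inter> U0)" if "continuous_on U0 e" for e
  proof -
    have "continuous_on U0 (\<lambda>q. e q \<bullet> dir c)" using that by (intro continuous_intros)
    then show ?thesis unfolding continuous_on_open_vimage[OF U0(1)] by simp
  qed
  from this[OF e(1)] this[OF e(2)] have openU: "open U" unfolding U_def by blast
  have pU: "p \<in> U" using U0 ec by (simp add: U_def)
  have UU0: "U \<subseteq> U0" by (auto simp: U_def)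
  define ang where "ang e = c + arctan (wedge (dir c) e / (e \<bullet> dir c))" for e
  have cont: "continuous_on U (\<lambda>q. ang (k q))"
    if "continuous_on U0 k" "\<And>q. q \<in> U \<Longrightarrow> k q \<bullet> dir c > 0" for k
    unfolding ang_def using continuous_on_subset[OF that(1) UU0] that(2)
    by (intro continuous_intros) (auto simp: less_imp_neq[symmetric])
  have pos: "e1 q \<bullet> dir c > 0" "e2 q \<bullet> dir c > 0" if "q \<in> U" for q
    using that by (auto simp: U_def)
  show "\<exists>U a b. open U \<and> p \<in> U \<and> continuous_on U a \<and> continuous_on U b \<and>
      (\<forall>q\<in>U. 0 < b q - a q \<and> b q - a q < pi \<and> C q = sector (a q) (b q) \<union> uminus ` sector (a q) (b q))"
  proof (intro exI conjI ballI)
    show "open U" "p \<in> U" by (fact openU pU)+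
    show "continuous_on U (\<lambda>q. ang (e1 q))" "continuous_on U (\<lambda>q. ang (e2 q))"
      using cont e pos by auto
    fix q assume q: "q \<in> U"
    let ?a = "ang (e1 q)" and ?b = "ang (e2 q)"
    obtain k1 where k1: "k1 > 0" "e1 q = k1 *\<^sub>R dir ?a"
      using polar_angle[OF pos(1)[OF q]] unfolding ang_def by blast
    obtain k2 where k2: "k2 > 0" "e2 q = k2 *\<^sub>R dir ?b"
      using polar_angle[OF pos(2)[OF q]] unfolding ang_def by blast
    note k = k1(1) k2(1) k1(2) k2(2)
    have qU0: "q \<in> U0" using q UU0 by blast
    have bounds: "?b - ?a < pi" "- pi < ?b - ?a"
      using arctan_bounded[of "wedge (dir c) (e1 q) / (e1 q \<bullet> dir c)"]
        arctan_bounded[of "wedge (dir c) (e2 q) / (e2 q \<bullet> dir c)"]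
      unfolding ang_def by linarith+
    have "wedge (k1 *\<^sub>R dir ?a) (k2 *\<^sub>R dir ?b) > 0"
      using w[OF qU0] unfolding k(3,4)[symmetric] .
    then have "sin (?b - ?a) > 0"
      using k(1,2) unfolding wedge_scaleR wedge_dir by (simp add: zero_less_mult_iff)
    then show pos_ba: "0 < ?b - ?a"
      using bounds sin_ge_zero[of "?a - ?b"] sin_minus[of "?b - ?a"] by (cases "?b \<le> ?a") simp_all
    show "?b - ?a < pi" by (fact bounds(1))
    have "v \<in> C q \<longleftrightarrow> v \<in> sector ?a ?b \<union> uminus ` sector ?a ?b" for v
    proof -
      have "v \<in> C q \<longleftrightarrow> wedge (k1 *\<^sub>R dir ?a) v * wedge v (k2 *\<^sub>R dir ?b) \<ge> 0"
        unfolding C[OF qU0] k(3,4)[symmetric] by simp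
      also have "\<dots> \<longleftrightarrow> (k1 * k2) * (wedge (dir ?a) v * wedge v (dir ?b)) \<ge> 0"
        by (simp add: mult_ac)
      also have "\<dots> \<longleftrightarrow> wedge (dir ?a) v * wedge v (dir ?b) \<ge> 0"
        using mult_pos_pos[OF k(1,2)] by (simp add: zero_le_mult_iff[of "k1 * k2"])
      finally show ?thesis unfolding double_sector_iff[OF pos_ba bounds(1)] .
    qed
    then show "C q = sector ?a ?b \<union> uminus ` sector ?a ?b" by blast
  qed
qed

section \<open>The unstable cone family\<close>

lemma unst_plus_one: "unst (y + 1) = - unst y" and cent_plus_one: "cent (y + 1) = - cent y"
  by (simp_all add: unst_def cent_def sn_plus_one cn_plus_one vector2_arith)

lemma continuous_on_unst: "continuous_on UNIV unst"
  unfolding unst_def by (intro continuous_intros)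

lemma continuous_on_cent: "continuous_on UNIV cent"
  unfolding cent_def by (intro continuous_intros)

text \<open>The vectors \<open>s * unst + t * cent\<close> with \<open>\<bar>t\<bar> \<le> \<bar>s\<bar> / 2\<close>. The condition is the same for the negated
  frame, so the cone is periodic in \<open>y\<close>. The aperture \<open>1/2\<close> is small enough for the Euclidean norm to
  grow on the cone.\<close>

definition cone_at :: "real \<Rightarrow> (real^2) set" where
  "cone_at y = {v. \<bar>wedge (unst y) v\<bar> \<le> \<bar>wedge v (cent y)\<bar> / 2}"

definition ucone :: "torus \<Rightarrow> (real^2) set" where
  "ucone p = cone_at (rep_torus p $ 2)"

lemma cone_at_plus_int: "cone_at (y + of_int n) = cone_at y"
proof (induction n rule: int_induct[where k = 0])
  have step: "cone_at (y + 1) = cone_at y" for y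
    by (simp add: cone_at_def unst_plus_one cent_plus_one)
  {
    case (step1 i)
    then show ?case using step[of "y + of_int i"] by (simp add: algebra_simps)
  next
    case (step2 i)
    then show ?case using step[of "y + of_int (i - 1)"] by (simp add: algebra_simps)
  }
qed simp

lemma ucone_torus_proj: "ucone (torus_proj x) = cone_at (x $ 2)"
proof -
  have "torus_proj (rep_torus (torus_proj x)) = torus_proj x" by simp
  then have "rep_torus (torus_proj x) $ 2 - x $ 2 \<in> \<int>"
    unfolding torus_proj_eq_iff by blast
  then obtain n where "rep_torus (torus_proj x) $ 2 - x $ 2 = of_int n"
    by (auto elim: Ints_cases)
  then have "rep_torus (torus_proj x) $ 2 = x $ 2 + of_int n" by simp
  then show ?thesis by (simp add: ucone_def cone_at_plus_int)
qed

lemma cent_norm: "norm (cent y) = 1"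
  by (simp add: norm_vec_def L2_set_def sum_2 cent_def add.commute[of "(cn y)\<^sup>2"] sn_cn_squared)

lemma unst_inner_self: "unst y \<bullet> unst y = 1 + (cn y)\<^sup>2 - (cn y)^4"
proof -
  have "(sn y)\<^sup>2 = 1 - (cn y)\<^sup>2" using sn_cn_squared[of y] by simp
  then show ?thesis
    unfolding unst_def inner_vec_def sum_2 by simp algebra
qed

text \<open>With \<open>z = cn\<^sup>2\<close> the squared norm is \<open>1 + z - z\<^sup>2\<close>, which lies between \<open>1\<close> and \<open>5/4\<close>.\<close>

lemma unst_norm_bounds: "1 \<le> norm (unst y)" "norm (unst y) \<le> 9/8"
proof -
  define z where "z = (cn y)\<^sup>2"
  have z: "0 \<le> z" "z \<le> 1"
    using sn_cn_squared[of y] zero_le_power2[of "sn y"] zero_le_power2[of "cn y"]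
    unfolding z_def by linarith+
  have nz: "(norm (unst y))\<^sup>2 = 1 + z - z\<^sup>2"
    unfolding power2_norm_eq_inner unst_inner_self z_def by simp
  have "z\<^sup>2 \<le> z" using z by (simp add: power2_eq_square mult_left_le)
  then have "1\<^sup>2 \<le> (norm (unst y))\<^sup>2" by (simp add: nz)
  then show "1 \<le> norm (unst y)" by (rule power2_le_imp_le) simp
  have "(norm (unst y))\<^sup>2 = 5/4 - (z - 1/2)\<^sup>2"
    unfolding nz by (simp add: power2_eq_square algebra_simps)
  also have "\<dots> \<le> (9/8)\<^sup>2"
  proof -
    have "5/4 \<le> (9/8 :: real)\<^sup>2" by (simp add: power2_eq_square)
    then show ?thesis using zero_le_power2[of "z - 1/2"] by linarith
  qed
  finally show "norm (unst y) \<le> 9/8" by (rule power2_le_imp_le) simp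
qed

lemma cone_at_edges:
  "cone_at y = {v. wedge (unst y - (1/2) *\<^sub>R cent y) v * wedge v (unst y + (1/2) *\<^sub>R cent y) \<ge> 0}"
proof -
  have "wedge (unst y - (1/2) *\<^sub>R cent y) v * wedge v (unst y + (1/2) *\<^sub>R cent y)
      = (wedge v (cent y) / 2)\<^sup>2 - (wedge (unst y) v)\<^sup>2" for v
    unfolding wedge_add wedge_diff wedge_scaleR
    using wedge_commute[of "cent y" v] wedge_commute[of v "unst y"]
    by (simp add: power2_eq_square algebra_simps)
  then show ?thesis
    unfolding cone_at_def by (auto simp: abs_le_square_iff[symmetric])
qed

lemma dir_exists: "v \<noteq> 0 \<Longrightarrow> \<exists>c. v = norm v *\<^sub>R dir c"
proof -
  assume v: "v \<noteq> 0"
  have eq: "(v $ 1 / norm v)\<^sup>2 + (v $ 2 / norm v)\<^sup>2 = 1"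
    using v by (simp add: norm_vec_def L2_set_def sum_2 power_divide flip: add_divide_distrib)
      (simp add: vector2_eq_iff sum_power2_eq_zero_iff)
  obtain c where c: "v $ 1 / norm v = cos c" "v $ 2 / norm v = sin c"
    by (rule sincos_total_2pi[OF eq])
  have "v $ i = norm v * (v $ i / norm v)" for i using v by simp
  then have "v = norm v *\<^sub>R dir c"
    unfolding vector2_eq_iff[of v] dir_def vector_scaleR_component vector_2 c[symmetric] real_scaleR_def
    by blast
  then show ?thesis ..
qed

text \<open>The edges are \<open>unst\<close> plus or minus half of \<open>cent\<close>. As \<open>unst\<close> has norm at least \<open>1\<close> and \<open>cent\<close> has norm \<open>1\<close>,
  both edges form an acute angle with \<open>unst\<close>.\<close>

lemma cone_family_ucone: "cone_family ucone"
proof (rule cone_family_from_edges)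
  fix p
  obtain x where p: "p = torus_proj x" by (rule torus_proj_cases)
  obtain U \<sigma> where U: "open U" "torus_proj x \<in> U" "continuous_on U \<sigma>"
    "\<And>q. q \<in> U \<Longrightarrow> torus_proj (\<sigma> q) = q" "\<sigma> (torus_proj x) = x"
    using torus_local_section[of x] by blast
  define e1 where "e1 y = unst y - (1/2) *\<^sub>R cent y" for y
  define e2 where "e2 y = unst y + (1/2) *\<^sub>R cent y" for y
  have e: "continuous_on UNIV e1" "continuous_on UNIV e2"
    unfolding e1_def e2_def by (intro continuous_intros continuous_on_unst continuous_on_cent)+
  have s2: "continuous_on U (\<lambda>q. \<sigma> q $ 2)" using U(3) by (intro continuous_intros)
  have S1: "norm (unst (x $ 2)) \<ge> 1" by (rule unst_norm_bounds)
  then obtain c where c: "unst (x $ 2) = norm (unst (x $ 2)) *\<^sub>R dir c"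
    using dir_exists by (metis norm_zero not_one_le_zero)
  have uc: "unst (x $ 2) \<bullet> dir c = norm (unst (x $ 2))"
    by (subst c) simp
  have nd: "norm (dir c) = 1" by (simp add: norm_eq_sqrt_inner)
  have tc: "\<bar>cent (x $ 2) \<bullet> dir c\<bar> \<le> 1"
    using Cauchy_Schwarz_ineq2[of "cent (x $ 2)" "dir c"] by (simp add: nd cent_norm)
  have ec: "e1 (x $ 2) \<bullet> dir c > 0" "e2 (x $ 2) \<bullet> dir c > 0"
    unfolding e1_def e2_def inner_diff_left inner_add_left inner_scaleR_left uc
    using tc S1 by linarith+
  have w: "wedge (e1 y) (e2 y) > 0" for y
    using wedge_commute[of "cent y" "unst y"]
    by (simp add: e1_def e2_def wedge_add wedge_diff wedge_frame)
  have cone: "ucone q = {v. wedge (e1 (\<sigma> q $ 2)) v * wedge v (e2 (\<sigma> q $ 2)) \<ge> 0}" if "q \<in> U" for q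
    using ucone_torus_proj[of "\<sigma> q"] U(4)[OF that] by (simp add: cone_at_edges e1_def e2_def)
  show "\<exists>U e1 e2 c. open U \<and> p \<in> U \<and> continuous_on U e1 \<and> continuous_on U e2 \<and>
      e1 p \<bullet> dir c > 0 \<and> e2 p \<bullet> dir c > 0 \<and>
      (\<forall>q\<in>U. wedge (e1 q) (e2 q) > 0 \<and> ucone q = {v. wedge (e1 q) v * wedge v (e2 q) \<ge> 0})"
  proof (rule exI[of _ U], rule exI[of _ "\<lambda>q. e1 (\<sigma> q $ 2)"], rule exI[of _ "\<lambda>q. e2 (\<sigma> q $ 2)"],
      rule exI[of _ c], intro conjI ballI)
    show "open U" "p \<in> U" using U(1,2) by (simp_all add: p)
    show "continuous_on U (\<lambda>q. e1 (\<sigma> q $ 2))" "continuous_on U (\<lambda>q. e2 (\<sigma> q $ 2))"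
      by (rule continuous_on_compose2[OF e(1) s2] continuous_on_compose2[OF e(2) s2], simp)+
    show "e1 (\<sigma> p $ 2) \<bullet> dir c > 0" "e2 (\<sigma> p $ 2) \<bullet> dir c > 0"
      using ec by (simp_all add: p U(5))
  qed (rule w, erule cone)
qed

lemma dlift_frame:
  "dlift y v = (4 / damp y * wedge v (cent y)) *\<^sub>R unst (circ y)
    + (2 / (damp y)^3 * wedge (unst y) v) *\<^sub>R cent (circ y)"
proof -
  have "dlift y v = dlift y (wedge v (cent y) *\<^sub>R unst y + wedge (unst y) v *\<^sub>R cent y)"
    by (rule arg_cong[OF frame_expansion])
  also have "\<dots> = wedge v (cent y) *\<^sub>R dlift y (unst y) + wedge (unst y) v *\<^sub>R dlift y (cent y)"
    by (simp only: linear_add[OF linear_dlift] linear_scale[OF linear_dlift])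
  finally show ?thesis by (simp add: dlift_unst dlift_cent mult.commute)
qed

lemma wedge_dlift:
  "wedge (dlift y v) (cent (circ y)) = 4 / damp y * wedge v (cent y)"
  "wedge (unst (circ y)) (dlift y v) = 2 / (damp y)^3 * wedge (unst y) v"
  unfolding dlift_frame wedge_add wedge_scaleR by (simp_all add: wedge_frame)

lemma cone_at_wedge_nonzero:
  assumes "v \<in> cone_at y" "v \<noteq> 0" shows "wedge v (cent y) \<noteq> 0"
  using assms frame_expansion[of v y] unfolding cone_at_def by force

text \<open>The coefficient ratio \<open>t / s\<close> is multiplied by \<open>1 / (2 * damp\<^sup>2) \<le> 1/2\<close>.\<close>

lemma dlift_cone_strict:
  assumes "v \<in> cone_at y" "v \<noteq> 0"
  shows "\<bar>wedge (unst (circ y)) (dlift y v)\<bar> < \<bar>wedge (dlift y v) (cent (circ y))\<bar> / 2"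
proof -
  let ?s = "\<bar>wedge v (cent y)\<bar>" and ?t = "\<bar>wedge (unst y) v\<bar>" and ?d = "damp y"
  have d: "?d \<ge> 1" by (rule damp_bounds)
  have s: "?s > 0" using cone_at_wedge_nonzero[OF assms] by simp
  have t: "?t \<le> ?s / 2" using assms(1) by (simp add: cone_at_def)
  have "?d \<le> ?d ^ 3" using d self_le_power[of ?d 3] by simp
  then have "2 / ?d^3 \<le> 2 / ?d" using d by (intro divide_left_mono) auto
  then have "2 / ?d^3 * ?t \<le> 2 / ?d * (?s / 2)"
    using t d by (intro mult_mono) auto
  also have "\<dots> < 4 / ?d * ?s / 2" using s d by (simp add: field_simps)
  finally show ?thesis
    using d unfolding wedge_dlift by (simp add: abs_mult)
qed

text \<open>On the cone the norm of the image is at least \<open>(4/d - 1/d\<^sup>3) \<bar>s\<bar> \<ge> 15/8 \<bar>s\<bar>\<close>, where \<open>d\<close> is \<open>damp\<close>,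
  and the norm of the vector itself is at most \<open>(9/8 + 1/2) \<bar>s\<bar> = 13/8 \<bar>s\<bar>\<close>.\<close>

lemma norm_dlift_cone:
  assumes "v \<in> cone_at y" "v \<noteq> 0"
  shows "norm v < norm (dlift y v)"
proof -
  let ?s = "\<bar>wedge v (cent y)\<bar>" and ?t = "\<bar>wedge (unst y) v\<bar>" and ?d = "damp y"
  have d: "?d \<ge> 1" "?d \<le> 2" by (rule damp_bounds)+
  have s: "?s > 0" using cone_at_wedge_nonzero[OF assms] by simp
  have t: "?t \<le> ?s / 2" using assms(1) by (simp add: cone_at_def)
  have "norm v \<le> ?s * norm (unst y) + ?t * norm (cent y)"
    by (subst frame_expansion[of v y]) (rule norm_triangle_le, simp)
  also have "\<dots> \<le> ?s * (9/8) + ?s / 2"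
    using unst_norm_bounds(2)[of y] t by (intro add_mono mult_left_mono) (auto simp: cent_norm)
  also have "\<dots> < 15/8 * ?s" using s by simp
  also have "\<dots> \<le> (4 / ?d - 1 / ?d^3) * ?s"
  proof (intro mult_right_mono)
    \<comment> \<open>This product is \<open>32 * d\<^sup>2 - 8 - 15 * d^3\<close>, the difference of the two sides after clearing denominators.\<close>
    have "(2 - ?d) * (15 * ?d\<^sup>2 - 2 * ?d - 4) \<ge> 0"
    proof (intro mult_nonneg_nonneg)
      have "?d * 1 \<le> ?d * ?d" using d by (intro mult_left_mono) auto
      then show "0 \<le> 15 * ?d\<^sup>2 - 2 * ?d - 4"
        using d unfolding power2_eq_square by linarith
    qed (use d in simp)
    then show "15/8 \<le> 4 / ?d - 1 / ?d^3"
      using d by (simp add: field_simps power2_eq_square power3_eq_cube)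
  qed simp
  also have "\<dots> = 4 / ?d * ?s - 2 / ?d^3 * (?s / 2)" by (simp add: left_diff_distrib)
  also have "\<dots> \<le> 4 / ?d * ?s * norm (unst (circ y)) - 2 / ?d^3 * ?t * norm (cent (circ y))"
  proof (intro diff_mono)
    have "4 / ?d * ?s * 1 \<le> 4 / ?d * ?s * norm (unst (circ y))"
      using d s unst_norm_bounds(1)[of "circ y"] by (intro mult_left_mono) auto
    then show "4 / ?d * ?s \<le> 4 / ?d * ?s * norm (unst (circ y))" by simp
    have "2 / ?d^3 * ?t \<le> 2 / ?d^3 * (?s / 2)"
      using d t by (intro mult_left_mono) auto
    then show "2 / ?d^3 * ?t * norm (cent (circ y)) \<le> 2 / ?d^3 * (?s / 2)" by (simp add: cent_norm)
  qed
  also have "\<dots> \<le> norm (dlift y v)"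
    unfolding dlift_frame
    using norm_diff_ineq[of "(4 / damp y * wedge v (cent y)) *\<^sub>R unst (circ y)"
        "(2 / (damp y)^3 * wedge (unst y) v) *\<^sub>R cent (circ y)"] d
    by (simp add: abs_mult)
  finally show ?thesis .
qed

lemma smooth_const: "smooth (\<lambda>x. c)"
  by (coinduction arbitrary: c) (auto simp: frechet_derivative_const)

lemma unstable_cone_family_ucone: "unstable_cone_family endo ucone"
  unfolding unstable_cone_family_def
proof (intro conjI allI)
  show "cone_family ucone" by (rule cone_family_ucone)
  fix p
  obtain x where p: "p = torus_proj x" by (rule torus_proj_cases)
  let ?y = "x $ 2"
  have fp: "endo p = torus_proj (lift x)" by (simp add: p endo_torus_proj)
  have y': "lift x $ 2 = circ ?y" by (simp add: lift_def)
  show "torus_deriv endo p ` ucone p - {0} \<subseteq> interior (ucone (endo p))"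
  proof
    fix w assume w: "w \<in> torus_deriv endo p ` ucone p - {0}"
    then obtain v where v: "w = dlift ?y v" "v \<in> cone_at ?y"
      by (auto simp: p torus_deriv_endo ucone_torus_proj)
    have "v \<noteq> 0" using w v linear_0[OF linear_dlift] by auto
    define O' where "O' = {u. \<bar>wedge (unst (circ ?y)) u\<bar> < \<bar>wedge u (cent (circ ?y))\<bar> / 2}"
    have "open O'" unfolding O'_def
      by (intro open_Collect_less continuous_intros) auto
    moreover have "w \<in> O'" using dlift_cone_strict[OF v(2) \<open>v \<noteq> 0\<close>] by (simp add: O'_def v(1))
    moreover have "O' \<subseteq> ucone (endo p)"
      unfolding fp ucone_torus_proj y' O'_def cone_at_def by auto
    ultimately show "w \<in> interior (ucone (endo p))"
      by (rule interiorI)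
  qed
next
  have "riemannian_metric (\<lambda>p u v. u \<bullet> v)"
    unfolding riemannian_metric_def using bilinear_conv_bounded_bilinear bounded_bilinear_inner
    by (auto simp: smooth_const inner_commute)
  moreover have "1 < metric_norm (\<lambda>p u v. u \<bullet> v) (endo p) (torus_deriv endo p v)"
    if "v \<in> ucone p" "metric_norm (\<lambda>p u v. u \<bullet> v) p v = 1" for p v
  proof -
    obtain x where p: "p = torus_proj x" by (rule torus_proj_cases)
    have v: "norm v = 1" using that(2) unfolding metric_norm_def norm_eq_sqrt_inner .
    then have "v \<noteq> 0" by auto
    moreover have "v \<in> cone_at (x $ 2)" using that(1) by (simp add: p ucone_torus_proj)
    ultimately have "1 < norm (dlift (x $ 2) v)"
      using norm_dlift_cone v by metis
    then show ?thesis
      unfolding p torus_deriv_endo metric_norm_def norm_eq_sqrt_inner .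
  qed
  ultimately show "\<exists>m. riemannian_metric m \<and>
      (\<forall>p. \<forall>v\<in>ucone p. metric_norm m p v = 1 \<longrightarrow> 1 < metric_norm m (endo p) (torus_deriv endo p v))"
    by blast
qed

lemma partially_hyperbolic_endo: "partially_hyperbolic endo"
  unfolding partially_hyperbolic_def using endo_C1_local_diffeo unstable_cone_family_ucone by blast

section \<open>The linearisation\<close>

definition linearisation :: "int^2^2" where
  "linearisation = vector [vector [2, 0], vector [0, 1]]"

lemma linearisation_mult:
  "map_matrix of_int linearisation *v (x :: ('a::comm_ring_1)^2) = vector [2 * x $ 1, x $ 2]"
  by (simp add: vector2_eq_iff matrix_vector_mult_def sum_2 map_matrix_def linearisation_def)

lemma non_hyperbolic_linearisation: "non_hyperbolic linearisation"
proof -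
  have "is_eigenvalue linearisation 2"
    unfolding is_eigenvalue_def linearisation_mult
    by (rule exI[of _ "vector [1, 0]"]) (simp add: vector2_eq_iff)
  moreover have "is_eigenvalue linearisation 1"
    unfolding is_eigenvalue_def linearisation_mult
    by (rule exI[of _ "vector [0, 1]"]) (simp add: vector2_eq_iff)
  ultimately show ?thesis
    unfolding non_hyperbolic_def by (intro exI[of _ 2] exI[of _ 1] conjI) auto
qed

lemma continuous_on_locally:
  assumes "\<And>x. \<exists>B. open B \<and> x \<in> B \<and> continuous_on B k"
  shows "continuous_on UNIV k"
proof -
  have "\<Union>{B. open B \<and> continuous_on B k} = UNIV" using assms by blast
  moreover have "continuous_on (\<Union>{B. open B \<and> continuous_on B k}) k"
    by (rule continuous_on_open_Union) auto
  ultimately show ?thesis by (simp only:)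
qed

text \<open>Straight-line homotopy, in the plane, from the lift at \<open>t = 0\<close> to \<open>diag(2, 1)\<close> at \<open>t = 1\<close>.\<close>

definition straight :: "real \<Rightarrow> real^2 \<Rightarrow> real^2" where
  "straight t x = vector [2 * x $ 1 + (1 - t) * shear (x $ 2), x $ 2 + (1 - t) * (circ (x $ 2) - x $ 2)]"

lemma straight_congruent:
  assumes "torus_proj x = torus_proj x'"
  shows "torus_proj (straight t x) = torus_proj (straight t x')"
proof -
  obtain m n where x: "x $ 1 = x' $ 1 + of_int m" "x $ 2 = x' $ 2 + of_int n"
    using assms by (rule torus_proj_eqE)
  have "straight t x $ 1 - straight t x' $ 1 = of_int (2 * m)"
    "straight t x $ 2 - straight t x' $ 2 = of_int n"
    unfolding straight_def x circ_plus_int shear_plus_int by simp_all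
  then show ?thesis
    unfolding torus_proj_eq_iff forall_2 by (metis Ints_of_int)
qed

lemma continuous_on_shear: "continuous_on UNIV shear" and continuous_on_circ: "continuous_on UNIV circ"
  using DERIV_isCont[OF shear_deriv] DERIV_isCont[OF circ_deriv]
  by (auto intro: continuous_at_imp_continuous_on)

text \<open>The straight-line homotopy descends to the torus because all its stages translate compatibly under
  integer vectors; loops are then moved along it.\<close>

lemma is_linearisation_endo: "is_linearisation endo linearisation"
  unfolding is_linearisation_def same_on_pi1_def
proof (intro allI impI, elim conjE)
  fix \<gamma> :: "real \<Rightarrow> torus"
  assume \<gamma>: "path \<gamma>" "pathfinish \<gamma> = pathstart \<gamma>"
  define K where "K = (\<lambda>(t, p). torus_proj (straight t (rep_torus p)))"
  have K: "K (t, torus_proj x) = torus_proj (straight t x)" for t x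
    unfolding K_def prod.case by (rule straight_congruent) simp
  have "continuous_on UNIV K"
  proof (rule continuous_on_locally)
    fix z :: "real \<times> torus"
    obtain x where x: "snd z = torus_proj x" by (rule torus_proj_cases)
    obtain U \<sigma> where U: "open U" "torus_proj x \<in> U" "continuous_on U \<sigma>"
      "\<And>q. q \<in> U \<Longrightarrow> torus_proj (\<sigma> q) = q" "\<sigma> (torus_proj x) = x"
      using torus_local_section[of x] by blast
    have "continuous_on (UNIV \<times> U) (\<lambda>w. \<sigma> (snd w))"
      by (rule continuous_on_compose2[OF U(3)]) (auto intro: continuous_intros)
    then have s: "continuous_on (UNIV \<times> U) (\<lambda>w. \<sigma> (snd w) $ i)" for i
      by (intro continuous_intros)
    have "continuous_on (UNIV \<times> U) (\<lambda>w. straight (fst w) (\<sigma> (snd w)))"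
      unfolding straight_def
      by (intro continuous_intros s continuous_on_compose2[OF continuous_on_shear s]
          continuous_on_compose2[OF continuous_on_circ s]) auto
    then have "continuous_on (UNIV \<times> U) (\<lambda>w. torus_proj (straight (fst w) (\<sigma> (snd w))))"
      by (intro continuous_on_compose2[OF continuous_on_torus_proj[of UNIV]]) auto
    moreover have "K w = torus_proj (straight (fst w) (\<sigma> (snd w)))" if "w \<in> UNIV \<times> U" for w
      using K[of "fst w" "\<sigma> (snd w)"] U(4)[of "snd w"] that by (auto simp: mem_Times_iff)
    ultimately have "continuous_on (UNIV \<times> U) K"
      by (metis (no_types, lifting) continuous_on_eq)
    moreover have "z \<in> UNIV \<times> U" using U(2) x by (simp add: mem_Times_iff)
    ultimately show "\<exists>B. open B \<and> z \<in> B \<and> continuous_on B K"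
      using open_Times[OF open_UNIV U(1)] by blast
  qed
  note contK = this
  let ?Q = "{0..1} \<times> {0..1} :: (real \<times> real) set"
  have "continuous_on ?Q (\<lambda>w. \<gamma> (snd w))"
    by (rule continuous_on_compose2[OF \<gamma>(1)[unfolded path_def] continuous_on_snd[OF continuous_on_id]])
      auto
  then have "continuous_on ?Q (\<lambda>w. (fst w, \<gamma> (snd w)))"
    by (rule continuous_on_Pair[OF continuous_on_fst[OF continuous_on_id]])
  then have "continuous_on ?Q (\<lambda>w. K (fst w, \<gamma> (snd w)))"
    by (rule continuous_on_compose2[OF contK]) simp
  moreover have "K (0, p) = endo p" for p
    by (rule torus_proj_cases[of p]) (simp add: K endo_torus_proj straight_def lift_def)
  moreover have "K (1, p) = toral_endo linearisation p" for p
    by (rule torus_proj_cases[of p])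
      (simp add: K toral_endo_torus_proj linearisation_mult straight_def)
  ultimately show "homotopic_loops UNIV (endo \<circ> \<gamma>) (toral_endo linearisation \<circ> \<gamma>)"
    unfolding homotopic_loops using \<gamma>(2)
    by (intro exI[of _ "\<lambda>w. K (fst w, \<gamma> (snd w))"]) (simp add: pathfinish_def pathstart_def)
qed

section \<open>The centre direction\<close>

text \<open>The converse of the construction of cones from edges, for an arbitrary cone family.\<close>

lemma cone_family_wedge:
  assumes "cone_family C"
  shows "\<exists>U A B. open U \<and> p \<in> U \<and> continuous_on U A \<and> continuous_on U B \<and>
    (\<forall>q\<in>U. wedge (A q) (B q) > 0 \<and> C q = {v. wedge (A q) v * wedge v (B q) \<ge> 0})"
proof -
  obtain U a b where U: "open U" "p \<in> U" "continuous_on U a" "continuous_on U b"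
    and all: "\<forall>q\<in>U. 0 < b q - a q \<and> b q - a q < pi \<and>
        C q = sector (a q) (b q) \<union> uminus ` sector (a q) (b q)"
    using assms[unfolded cone_family_def, THEN spec, of p] by (elim exE conjE)
  have ab: "0 < b q - a q" "b q - a q < pi"
    and C: "C q = sector (a q) (b q) \<union> uminus ` sector (a q) (b q)" if "q \<in> U" for q
    using all that by simp_all
  have cd: "continuous_on UNIV dir" unfolding dir_def by (intro continuous_intros)
  show ?thesis
  proof (rule exI[of _ U], rule exI[of _ "\<lambda>q. dir (a q)"], rule exI[of _ "\<lambda>q. dir (b q)"],
      intro conjI ballI U(1,2))
    show "continuous_on U (\<lambda>q. dir (a q))" "continuous_on U (\<lambda>q. dir (b q))"
      by (rule continuous_on_compose2[OF cd U(3)] continuous_on_compose2[OF cd U(4)], simp)+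
    fix q assume q: "q \<in> U"
    show "wedge (dir (a q)) (dir (b q)) > 0"
      unfolding wedge_dir using ab[OF q] by (rule sin_gt_zero)
    show "C q = {v. wedge (dir (a q)) v * wedge v (dir (b q)) \<ge> 0}"
      unfolding C[OF q] using double_sector_iff[OF ab[OF q]] by blast
  qed
qed

lemma cone_scaleR:
  assumes "cone_family C" "v \<in> C p" shows "r *\<^sub>R v \<in> C p"
proof -
  obtain A B where C: "C p = {v. wedge A v * wedge v B \<ge> 0}"
    using cone_family_wedge[OF assms(1), of p] by blast
  have "wedge A (r *\<^sub>R v) * wedge (r *\<^sub>R v) B = r\<^sup>2 * (wedge A v * wedge v B)"
    by (simp add: power2_eq_square)
  then show ?thesis using assms(2) unfolding C mem_Collect_eq by (metis zero_le_mult_iff zero_le_power2)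
qed

lemma zero_in_cone:
  assumes "cone_family C" shows "0 \<in> C p"
proof -
  obtain A B where "C p = {v. wedge A v * wedge v B \<ge> 0}"
    using cone_family_wedge[OF assms(1), of p] by blast
  then show ?thesis by simp
qed

lemma wedge_basis: "wedge A B *\<^sub>R v = wedge v B *\<^sub>R A + wedge A v *\<^sub>R B"
  by (simp add: vector2_eq_iff wedge_def) algebra

text \<open>If the product vanished at \<open>v\<close>, a small step from \<open>v\<close> in the direction \<open>w\<close> below would make it
  negative.\<close>

lemma interior_cone_wedge_pos:
  assumes AB: "wedge A B > 0" and v: "v \<in> interior {u. wedge A u * wedge u B \<ge> 0}" "v \<noteq> 0"
  shows "wedge A v * wedge v B > 0"
proof (rule ccontr)
  assume "\<not> ?thesis"
  moreover have "wedge A v * wedge v B \<ge> 0"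
    using v(1) interior_subset by blast
  ultimately have zero: "wedge A v * wedge v B = 0" by simp
  \<comment> \<open>Up to a positive factor, minus the vector whose coordinates in the basis \<open>A\<close>, \<open>B\<close> are those of \<open>v\<close>, interchanged.\<close>
  define w where "w = (- wedge v B) *\<^sub>R B - wedge A v *\<^sub>R A"
  have "(\<lambda>n. v + (1 / real (Suc n)) *\<^sub>R w) \<longlonglongrightarrow> v + 0 *\<^sub>R w"
    by (intro tendsto_intros LIMSEQ_inverse_real_of_nat[unfolded inverse_eq_divide])
  then have "\<forall>\<^sub>F n in sequentially. v + (1 / real (Suc n)) *\<^sub>R w \<in> interior {u. wedge A u * wedge u B \<ge> 0}"
    using v(1) by (intro topological_tendstoD) auto
  then obtain n where n: "v + (1 / real (Suc n)) *\<^sub>R w \<in> {u. wedge A u * wedge u B \<ge> 0}"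
    using interior_subset by (metis (no_types, lifting) eventually_sequentially order_refl subsetD)
  define e where "e = 1 / real (Suc n)"
  have e: "e > 0" by (simp add: e_def)
  have w1: "wedge A (v + e *\<^sub>R w) = wedge A v - e * (wedge v B * wedge A B)"
    and w2: "wedge (v + e *\<^sub>R w) B = wedge v B - e * (wedge A v * wedge A B)"
    by (simp_all add: w_def wedge_add wedge_diff algebra_simps)
  have "wedge A (v + e *\<^sub>R w) * wedge (v + e *\<^sub>R w) B
      = wedge A v * wedge v B * (1 + (e * wedge A B)\<^sup>2)
        - e * wedge A B * ((wedge v B)\<^sup>2 + (wedge A v)\<^sup>2)"
    unfolding w1 w2 by algebra
  then have "e * wedge A B * ((wedge v B)\<^sup>2 + (wedge A v)\<^sup>2) \<le> 0"
    using n unfolding e_def[symmetric] zero by simp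
  then have "(wedge v B)\<^sup>2 + (wedge A v)\<^sup>2 \<le> 0"
    using mult_pos_pos[OF e AB] by (meson linorder_not_le mult_pos_pos)
  then have "wedge v B = 0" "wedge A v = 0"
    by (simp_all add: sum_power2_le_zero_iff)
  then show False using wedge_basis[of A B v] AB v(2) by simp
qed

text \<open>The coefficients of the metric in the standard basis are continuous and periodic, hence bounded.\<close>

lemma metric_norm_bound:
  assumes "riemannian_metric m"
  shows "\<exists>M. \<forall>p v. (metric_norm m p v)\<^sup>2 \<le> M * (norm v)\<^sup>2"
proof -
  let ?e = "\<lambda>i::2. axis i 1 :: real^2"
  have "\<exists>K. \<forall>p. \<bar>m p (?e i) (?e j)\<bar> \<le> K" for i j
  proof -
    let ?h = "\<lambda>x. m (torus_proj x) (?e i) (?e j)"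
    have "smooth ?h" using assms by (simp add: riemannian_metric_def)
    then have "\<And>x. ?h differentiable (at x)" by (rule smooth.cases) blast
    then have "continuous_on UNIV ?h"
      by (simp add: continuous_at_imp_continuous_on differentiable_imp_continuous_within)
    then have "compact (?h ` cbox 0 1)"
      by (intro compact_continuous_image compact_cbox) (rule continuous_on_subset, auto)
    then have "bounded (?h ` cbox 0 1)" by (rule compact_imp_bounded)
    then obtain K where K: "\<And>x. x \<in> cbox 0 1 \<Longrightarrow> \<bar>?h x\<bar> \<le> K"
      unfolding bounded_iff by auto
    have "\<bar>m p (?e i) (?e j)\<bar> \<le> K" for p
    proof -
      obtain x where p: "p = torus_proj x" by (rule torus_proj_cases)
      \<comment> \<open>The representative in the unit square, where the bound \<open>K\<close> holds.\<close>
      define x' :: "real^2" where "x' = (\<chi> k. frac (x $ k))"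
      have "torus_proj x' = p"
        unfolding p torus_proj_eq_iff x'_def frac_def by simp
      moreover have "x' \<in> cbox 0 1"
        by (simp add: x'_def mem_box_cart frac_ge_0 frac_lt_1 less_imp_le)
      ultimately show ?thesis using K by metis
    qed
    then show ?thesis by blast
  qed
  then obtain K where K: "\<And>i j p. \<bar>m p (?e i) (?e j)\<bar> \<le> K i j" by metis
  define M where "M = K 1 1 + K 1 2 + K 2 1 + K 2 2"
  have "(metric_norm m p v)\<^sup>2 \<le> M * (norm v)\<^sup>2" for p v
  proof -
    have bil: "bilinear (m p)" using assms by (simp add: riemannian_metric_def)
    have "m p v v \<ge> 0"
      using assms linear_0[of "m p v"] bil unfolding riemannian_metric_def bilinear_def
      by (metis less_imp_le order_refl)
    then have "(metric_norm m p v)\<^sup>2 = m p v v" by (simp add: metric_norm_def)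
    also have "v = v $ 1 *\<^sub>R ?e 1 + v $ 2 *\<^sub>R ?e 2"
      by (simp add: vector2_eq_iff axis_def)
    then have "m p v v = m p (v $ 1 *\<^sub>R ?e 1 + v $ 2 *\<^sub>R ?e 2) (v $ 1 *\<^sub>R ?e 1 + v $ 2 *\<^sub>R ?e 2)"
      by (rule arg_cong)
    also have "\<dots> = v $ 1 * v $ 1 * m p (?e 1) (?e 1) + v $ 1 * v $ 2 * m p (?e 1) (?e 2)
        + v $ 2 * v $ 1 * m p (?e 2) (?e 1) + v $ 2 * v $ 2 * m p (?e 2) (?e 2)"
      by (simp add: bilinear_ladd[OF bil] bilinear_radd[OF bil] bilinear_lmul[OF bil]
          bilinear_rmul[OF bil] algebra_simps)
    also have "\<dots> \<le> (norm v)\<^sup>2 * K 1 1 + (norm v)\<^sup>2 * K 1 2 + (norm v)\<^sup>2 * K 2 1 + (norm v)\<^sup>2 * K 2 2"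
    proof -
      have "v $ i * v $ j * m p (?e i) (?e j) \<le> (norm v)\<^sup>2 * K i j" for i j
      proof -
        have "v $ i * v $ j * m p (?e i) (?e j) \<le> \<bar>v $ i * v $ j * m p (?e i) (?e j)\<bar>" by simp
        also have "\<dots> = \<bar>v $ i\<bar> * \<bar>v $ j\<bar> * \<bar>m p (?e i) (?e j)\<bar>" by (simp add: abs_mult)
        also have "\<dots> \<le> norm v * norm v * K i j"
          by (intro mult_mono component_le_norm_cart K) auto
        finally show ?thesis by (simp add: power2_eq_square)
      qed
      then show ?thesis by (intro add_mono)
    qed
    also have "\<dots> = M * (norm v)\<^sup>2" by (simp add: M_def algebra_simps)
    finally show ?thesis .
  qed
  then show ?thesis by blast
qed

text \<open>Expansion of unit vectors, by homogeneity.\<close>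

lemma metric_norm_expands:
  assumes m: "riemannian_metric m" and C: "cone_family C"
    and ex: "\<And>p v. v \<in> C p \<Longrightarrow> metric_norm m p v = 1 \<Longrightarrow> 1 < metric_norm m (endo p) (torus_deriv endo p v)"
    and v: "v \<in> C (torus_proj x)" "v \<noteq> 0"
  shows "metric_norm m (torus_proj x) v < metric_norm m (torus_proj (lift x)) (dlift (x $ 2) v)"
proof -
  have hom: "metric_norm m p (r *\<^sub>R u) = r * metric_norm m p u" if "r \<ge> 0" for p r u
  proof -
    have bil: "bilinear (m p)" using m by (simp add: riemannian_metric_def)
    have "m p (r *\<^sub>R u) (r *\<^sub>R u) = r\<^sup>2 * m p u u"
      by (simp add: bilinear_lmul[OF bil] bilinear_rmul[OF bil] power2_eq_square)
    then show ?thesis using that by (simp add: metric_norm_def real_sqrt_mult)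
  qed
  define n where "n = metric_norm m (torus_proj x) v"
  have n: "n > 0" using m v(2) by (simp add: n_def metric_norm_def riemannian_metric_def)
  have "metric_norm m (torus_proj x) ((1 / n) *\<^sub>R v) = 1"
    using n hom[of "1 / n" "torus_proj x" v] by (simp add: n_def)
  then have "1 < metric_norm m (endo (torus_proj x)) (torus_deriv endo (torus_proj x) ((1 / n) *\<^sub>R v))"
    by (intro ex cone_scaleR[OF C v(1)])
  also have "\<dots> = (1 / n) * metric_norm m (torus_proj (lift x)) (dlift (x $ 2) v)"
    using n by (simp add: endo_torus_proj torus_deriv_endo linear_scale[OF linear_dlift] hom)
  finally show ?thesis using n by (simp add: n_def field_simps)
qed

lemma dlift_cone:
  assumes "unstable_cone_family endo C" "v \<in> C (torus_proj x)"
  shows "dlift (x $ 2) v \<in> C (torus_proj (lift x))"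
proof (cases "dlift (x $ 2) v = 0")
  case True
  then show ?thesis using zero_in_cone assms(1) unfolding unstable_cone_family_def by simp
next
  case False
  have "torus_deriv endo (torus_proj x) ` C (torus_proj x) - {0} \<subseteq> interior (C (endo (torus_proj x)))"
    using assms(1) unfolding unstable_cone_family_def by blast
  then have "dlift (x $ 2) v \<in> interior (C (torus_proj (lift x)))"
    using assms(2) False unfolding torus_deriv_endo endo_torus_proj by blast
  then show ?thesis using interior_subset by blast
qed

lemma cent_nonzero [simp]: "cent y \<noteq> 0"
  using cent_norm[of y] by auto

text \<open>Suppose that such a cone contains \<open>cent\<close>. Then the images of \<open>cent\<close> stay in the cones, so their
  metric norm increases. On the other hand, the coefficient of \<open>cent\<close> divided by \<open>sn^3\<close> is multiplied by
  exactly \<open>1/4\<close> in each step, because \<open>2 / damp^3 = (1/4) * (2 / damp)^3\<close>. As \<open>sn\<close> is bounded, the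
  images tend to zero.\<close>

lemma cent_notin_cone_off_circle:
  assumes C: "unstable_cone_family endo C" and y: "sn (x $ 2) \<noteq> 0"
  shows "cent (x $ 2) \<notin> C (torus_proj x)"
proof
  assume in_C: "cent (x $ 2) \<in> C (torus_proj x)"
  obtain m where m: "riemannian_metric m"
    and ex: "\<And>p v. v \<in> C p \<Longrightarrow> metric_norm m p v = 1 \<Longrightarrow> 1 < metric_norm m (endo p) (torus_deriv endo p v)"
    using C unfolding unstable_cone_family_def by blast
  have Cf: "cone_family C" using C unfolding unstable_cone_family_def by blast
  obtain M where M: "\<And>p v. (metric_norm m p v)\<^sup>2 \<le> M * (norm v)\<^sup>2"
    using metric_norm_bound[OF m] by blast
  define m0 where "m0 = metric_norm m (torus_proj x) (cent (x $ 2))"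
  have m0: "m0 > 0" using m by (simp add: m0_def metric_norm_def riemannian_metric_def)
  define a where "a = sn (x $ 2)"
  have iter: "\<exists>z. let v = ((sn (z $ 2))^3 / (4^n * a^3)) *\<^sub>R cent (z $ 2) in
      sn (z $ 2) \<noteq> 0 \<and> v \<in> C (torus_proj z) \<and> m0 \<le> metric_norm m (torus_proj z) v" for n
  proof (induction n)
    case 0
    show ?case by (rule exI[of _ x]) (use y in_C in \<open>simp add: m0_def a_def\<close>)
  next
    case (Suc n)
    then obtain z where z: "sn (z $ 2) \<noteq> 0"
      and C': "((sn (z $ 2))^3 / (4^n * a^3)) *\<^sub>R cent (z $ 2) \<in> C (torus_proj z)" (is "?v \<in> _")
      and m': "m0 \<le> metric_norm m (torus_proj z) (((sn (z $ 2))^3 / (4^n * a^3)) *\<^sub>R cent (z $ 2))"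
      by (auto simp: Let_def)
    have l2: "lift z $ 2 = circ (z $ 2)" by (simp add: lift_def)
    have d: "damp (z $ 2) \<noteq> 0" using damp_bounds(1)[of "z $ 2"] by auto
    have "dlift (z $ 2) ?v = ((sn (lift z $ 2))^3 / (4^Suc n * a^3)) *\<^sub>R cent (lift z $ 2)"
      unfolding linear_scale[OF linear_dlift] dlift_cent l2 sn_circ
      using d y by (simp add: a_def field_simps power_mult_distrib)
    moreover have "dlift (z $ 2) ?v \<in> C (torus_proj (lift z))"
      by (rule dlift_cone[OF C C'])
    moreover have "?v \<noteq> 0" using z y by (simp add: a_def)
    then have "m0 \<le> metric_norm m (torus_proj (lift z)) (dlift (z $ 2) ?v)"
      using metric_norm_expands[OF m Cf ex C'] m' by simp
    moreover have "sn (lift z $ 2) \<noteq> 0" using z d by (simp add: l2 sn_circ)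
    ultimately show ?case by (intro exI[of _ "lift z"]) (simp add: Let_def)
  qed
  have bound: "m0\<^sup>2 \<le> \<bar>M\<bar> / a^6 * (1/16)^n" for n
  proof -
    obtain z where z: "m0 \<le> metric_norm m (torus_proj z) (((sn (z $ 2))^3 / (4^n * a^3)) *\<^sub>R cent (z $ 2))"
        (is "_ \<le> metric_norm m _ ?v")
      using iter[of n] by (auto simp: Let_def)
    have sixteen: "(4^n)\<^sup>2 = (16::real)^n"
      by (induction n) (simp_all add: power2_eq_square)
    have "m0\<^sup>2 \<le> (metric_norm m (torus_proj z) ?v)\<^sup>2"
      using z m0 by (intro power_mono) auto
    also have "\<dots> \<le> M * (norm ?v)\<^sup>2" by (rule M)
    also have "\<dots> \<le> \<bar>M\<bar> * (norm ?v)\<^sup>2" by (intro mult_right_mono) auto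
    also have "(norm ?v)\<^sup>2 = ((sn (z $ 2))\<^sup>2)^3 / (16^n * a^6)"
      using sixteen by (simp add: cent_norm power_divide power_mult_distrib flip: power_mult)
    also have "((sn (z $ 2))\<^sup>2)^3 \<le> 1"
      by (intro power_le_one sn_squared_le_1) simp
    then have "\<bar>M\<bar> * (((sn (z $ 2))\<^sup>2)^3 / (16^n * a^6)) \<le> \<bar>M\<bar> * (1 / (16^n * a^6))"
      by (intro mult_left_mono divide_right_mono) (auto simp: zero_le_even_power)
    also have "\<dots> = \<bar>M\<bar> / a^6 * (1/16)^n" by (simp add: power_divide)
    finally show ?thesis .
  qed
  have "(\<lambda>n. \<bar>M\<bar> / a^6 * (1/16)^n) \<longlonglongrightarrow> \<bar>M\<bar> / a^6 * 0"
    by (intro tendsto_intros LIMSEQ_realpow_zero) auto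
  then have "m0\<^sup>2 \<le> \<bar>M\<bar> / a^6 * 0"
    by (rule LIMSEQ_le_const) (use bound in blast)
  then show False using m0 by simp
qed

text \<open>On the circle \<open>y = 0\<close> the vector \<open>cent\<close> is expanded, and the growth argument does not apply. But if it
  lay in the cone, its image would lie in the interior of the next cone; by continuity of the cone
  family, \<open>cent\<close> would then lie in the cones at nearby points off the circle.\<close>

lemma cent_notin_cone:
  assumes C: "unstable_cone_family endo C"
  shows "cent (x $ 2) \<notin> C (torus_proj x)"
proof (cases "sn (x $ 2) = 0")
  case False
  then show ?thesis using cent_notin_cone_off_circle[OF C] by blast
next
  case True
  show ?thesis
  proof
    assume in_C: "cent (x $ 2) \<in> C (torus_proj x)"
    define z where "z = lift x"
    have z2: "z $ 2 = circ (x $ 2)" by (simp add: z_def lift_def)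
    have "sn (z $ 2) = 0" by (simp add: z2 sn_circ True)
    then have zint: "z $ 2 \<in> \<int>" by (simp add: sn_eq_0_iff)
    have Cf: "cone_family C" using C unfolding unstable_cone_family_def by blast
    obtain U A B where U: "open U" "torus_proj z \<in> U" "continuous_on U A" "continuous_on U B"
      and all: "\<forall>q\<in>U. wedge (A q) (B q) > 0 \<and> C q = {v. wedge (A q) v * wedge v (B q) \<ge> 0}"
      using cone_family_wedge[OF Cf, of "torus_proj z"] by (elim exE conjE)
    have AB: "wedge (A q) (B q) > 0" and CU: "C q = {v. wedge (A q) v * wedge v (B q) \<ge> 0}"
      if "q \<in> U" for q using all that by simp_all
    define k where "k = 2 / (damp (x $ 2))^3"
    have k: "k \<noteq> 0" using damp_bounds(1)[of "x $ 2"] by (simp add: k_def)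
    have dk: "dlift (x $ 2) (cent (x $ 2)) = k *\<^sub>R cent (z $ 2)"
      by (simp add: dlift_cent k_def z2)
    have "torus_deriv endo (torus_proj x) ` C (torus_proj x) - {0} \<subseteq> interior (C (endo (torus_proj x)))"
      using C unfolding unstable_cone_family_def by blast
    then have "k *\<^sub>R cent (z $ 2) \<in> interior (C (torus_proj z))"
      using in_C k dk unfolding torus_deriv_endo endo_torus_proj z_def[symmetric] by force
    then have "wedge (A (torus_proj z)) (k *\<^sub>R cent (z $ 2)) * wedge (k *\<^sub>R cent (z $ 2)) (B (torus_proj z)) > 0"
      unfolding CU[OF U(2)] using k by (intro interior_cone_wedge_pos AB U(2)) auto
    then have "k\<^sup>2 * (wedge (A (torus_proj z)) (cent (z $ 2)) * wedge (cent (z $ 2)) (B (torus_proj z))) > 0"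
      by (simp add: power2_eq_square mult_ac)
    then have pos: "wedge (A (torus_proj z)) (cent (z $ 2)) * wedge (cent (z $ 2)) (B (torus_proj z)) > 0"
      using k by (simp add: zero_less_mult_iff)
    define h where "h w = wedge (A (torus_proj w)) (cent (w $ 2)) * wedge (cent (w $ 2)) (B (torus_proj w))" for w
    let ?V = "torus_proj -` U"
    have V: "open ?V" by (rule open_torus_proj_vimage[OF U(1)])
    have cc: "continuous_on ?V (\<lambda>w. cent (w $ 2))"
      by (rule continuous_on_compose2[OF continuous_on_cent]) (auto intro: continuous_intros)
    have "continuous_on ?V (\<lambda>w. A (torus_proj w))" "continuous_on ?V (\<lambda>w. B (torus_proj w))"
      using continuous_on_compose2[OF U(3) continuous_on_torus_proj[of ?V]]
        continuous_on_compose2[OF U(4) continuous_on_torus_proj[of ?V]] by auto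
    then have "continuous_on ?V h" unfolding h_def by (intro continuous_intros cc)
    then have opn: "open (h -` {0<..} \<inter> ?V)"
      unfolding continuous_on_open_vimage[OF V] by simp
    have zin: "z \<in> h -` {0<..} \<inter> ?V" using pos U(2) by (simp add: h_def)
    obtain e where e: "e > 0" "ball z e \<subseteq> h -` {0<..} \<inter> ?V"
      using openE[OF opn zin] by blast
    \<comment> \<open>A point above \<open>z\<close>, close enough for the cone condition and less than \<open>1\<close> away, so that it is off the circle.\<close>
    define w where "w = z + min (e / 2) (1/2) *\<^sub>R axis 2 1"
    have "dist z w < e" using e(1) by (simp add: w_def dist_norm norm_axis_1)
    then have hw: "h w > 0" "torus_proj w \<in> U" using e(2) by auto
    have "w $ 2 - z $ 2 = min (e / 2) (1/2)" by (simp add: w_def axis_def)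
    then have "w $ 2 - z $ 2 \<notin> \<int>"
      using e(1) Ints_nonzero_abs_less1[of "w $ 2 - z $ 2"] by (auto simp: min_def split: if_splits)
    then have "w $ 2 \<notin> \<int>" using zint Ints_diff by blast
    then have "sn (w $ 2) \<noteq> 0" by (simp add: sn_eq_0_iff)
    moreover have "cent (w $ 2) \<in> C (torus_proj w)"
      using hw unfolding CU[OF hw(2)] by (simp add: h_def)
    ultimately show False using cent_notin_cone_off_circle[OF C] by blast
  qed
qed

lemma iterate_derivative_cent:
  "\<exists>L k. ((lift ^^ n) has_derivative L) (at x) \<and> k \<noteq> 0 \<and> L (cent (x $ 2)) = k *\<^sub>R cent ((lift ^^ n) x $ 2)"
proof (induction n)
  case 0
  show ?case by (intro exI[of _ "\<lambda>h. h"] exI[of _ 1]) (auto simp: id_def intro: derivative_intros)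
next
  case (Suc n)
  then obtain L k where L: "((lift ^^ n) has_derivative L) (at x)" "k \<noteq> 0"
    "L (cent (x $ 2)) = k *\<^sub>R cent ((lift ^^ n) x $ 2)" by blast
  let ?z = "(lift ^^ n) x"
  have "((\<lambda>x. lift ((lift ^^ n) x)) has_derivative (\<lambda>h. dlift (?z $ 2) (L h))) (at x)"
    by (rule has_derivative_compose[OF L(1) lift_has_derivative])
  then have "((lift ^^ Suc n) has_derivative (\<lambda>h. dlift (?z $ 2) (L h))) (at x)"
    by (simp add: o_def)
  moreover have "dlift (?z $ 2) (L (cent (x $ 2))) = (k * (2 / (damp (?z $ 2))^3)) *\<^sub>R cent ((lift ^^ Suc n) x $ 2)"
    by (simp add: L(3) linear_scale[OF linear_dlift] dlift_cent lift_def)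
  moreover have "k * (2 / (damp (?z $ 2))^3) \<noteq> 0"
    using L(2) damp_bounds(1)[of "?z $ 2"] by simp
  ultimately show ?case by blast
qed

lemma endo_iterate_torus_proj: "(endo ^^ n) (torus_proj x) = torus_proj ((lift ^^ n) x)"
  by (induction n) (simp_all add: endo_torus_proj)

text \<open>The line spanned by \<open>cent\<close> is invariant and avoids every cone, so it is the unique line with this
  property.\<close>

lemma centre_direction_eq:
  assumes C: "unstable_cone_family endo C" and E: "centre_direction endo C E"
  shows "E (torus_proj x) = span {cent (x $ 2)}"
proof -
  let ?l = "span {cent (x $ 2)}"
  have Cf: "cone_family C" using C unfolding unstable_cone_family_def by blast
  have "torus_deriv (endo ^^ n) (torus_proj x) ` ?l \<inter> C ((endo ^^ n) (torus_proj x)) = {0}" for n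
  proof -
    let ?z = "(lift ^^ n) x"
    obtain L k where L: "((lift ^^ n) has_derivative L) (at x)" "k \<noteq> 0"
      "L (cent (x $ 2)) = k *\<^sub>R cent (?z $ 2)"
      using iterate_derivative_cent by blast
    have "has_torus_derivative (endo ^^ n) L (torus_proj x)"
      by (rule has_torus_derivative_lift[OF open_UNIV _ _ L(1)]) (simp_all add: endo_iterate_torus_proj)
    then have d: "torus_deriv (endo ^^ n) (torus_proj x) = L" by (rule torus_deriv_eq)
    have lin: "linear L" by (rule has_derivative_linear[OF L(1)])
    have r0: "r = 0" if "L (r *\<^sub>R cent (x $ 2)) \<in> C (torus_proj ?z)" for r
    proof (rule ccontr)
      assume r: "r \<noteq> 0"
      have "(1 / (r * k)) *\<^sub>R L (r *\<^sub>R cent (x $ 2)) \<in> C (torus_proj ?z)"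
        by (rule cone_scaleR[OF Cf that])
      then have "cent (?z $ 2) \<in> C (torus_proj ?z)"
        using r L(2) by (simp add: linear_scale[OF lin] L(3))
      then show False using cent_notin_cone[OF C] by blast
    qed
    have "w = 0" if wl: "w \<in> L ` ?l" and wC: "w \<in> C (torus_proj ?z)" for w
    proof -
      obtain r where w: "w = L (r *\<^sub>R cent (x $ 2))"
        using wl by (auto simp: span_singleton)
      then have "r = 0" using wC r0 by blast
      then show ?thesis using w linear_0[OF lin] by simp
    qed
    moreover have "0 \<in> L ` ?l"
      using imageI[OF span_zero, of L "{cent (x $ 2)}"] by (simp only: linear_0[OF lin])
    ultimately show ?thesis
      unfolding d endo_iterate_torus_proj using zero_in_cone[OF Cf] by blast
  qed
  moreover have "is_line ?l"
    unfolding is_line_def using dim_span[of "{cent (x $ 2)}"] by (simp add: dim_singleton)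
  ultimately have "?l = E (torus_proj x)"
    using E unfolding centre_direction_def by blast
  then show ?thesis ..
qed

section \<open>Centre curves that merge into a circle\<close>

text \<open>The function \<open>\<chi>\<close> of the introduction, an antiderivative of \<open>cn/sn\<close> for \<open>0 < y < 1/2\<close>. It is continuous at \<open>0\<close>, where the
  derivative is infinite.\<close>

definition profile :: "real \<Rightarrow> real" where
  "profile y = (sn y * cn y + arcsin (sn y)) / 2"

lemma sn_0 [simp]: "sn 0 = 0" and cn_0 [simp]: "cn 0 = 1"
  by (simp_all add: sn_eq cn_eq)

lemma profile_0 [simp]: "profile 0 = 0"
  by (simp add: profile_def)

lemma continuous_on_profile [continuous_intros]:
  fixes h :: "'a::t2_space \<Rightarrow> real"
  shows "continuous_on A h \<Longrightarrow> continuous_on A (\<lambda>z. profile (h z))"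
  unfolding profile_def using sn_abs_le_1
  by (intro continuous_intros) (auto simp: abs_le_iff minus_le_iff)

lemma profile_deriv:
  assumes "0 < y" "y < 1/2"
  shows "(profile has_real_derivative cn y / sn y) (at y)"
proof -
  define a b where "a = sqrt (2 * y)" and "b = sqrt (1 - 2 * y)"
  have ab: "a > 0" "b > 0" "a\<^sup>2 + b\<^sup>2 = 1" using assms by (simp_all add: a_def b_def)
  have b': "sqrt (1 - a\<^sup>2) = b" using assms by (simp add: a_def b_def)
  have a1: "- 1 < sqrt (2 * y)" "sqrt (2 * y) < 1"
    using ab(1) assms unfolding a_def by (linarith, simp)
  have da: "((\<lambda>y. sqrt (2 * y)) has_real_derivative 1 / a) (at y)"
    using assms by (auto intro!: derivative_eq_intros simp: a_def field_simps)
  have db: "((\<lambda>y. sqrt (1 - 2 * y)) has_real_derivative - 1 / b) (at y)"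
    using assms by (auto intro!: derivative_eq_intros simp: b_def field_simps)
  have "((\<lambda>y. arcsin (sqrt (2 * y))) has_real_derivative inverse (sqrt (1 - a\<^sup>2)) * (1 / a)) (at y)"
    unfolding a_def by (intro DERIV_chain2[OF DERIV_arcsin[OF a1] da[unfolded a_def]])
  then have "((\<lambda>y. (sqrt (2 * y) * sqrt (1 - 2 * y) + arcsin (sqrt (2 * y))) / 2) has_real_derivative
      (1 / a * b + (- 1 / b) * a + inverse b * (1 / a)) / 2) (at y)"
    unfolding b' using DERIV_mult[OF da db] unfolding a_def[symmetric] b_def[symmetric]
    by (intro DERIV_cdivide DERIV_add)
  also have "(1 / a * b + (- 1 / b) * a + inverse b * (1 / a)) / 2 = b / a"
  proof -
    have "(1 / a * b + (- 1 / b) * a + inverse b * (1 / a)) / 2 = (b\<^sup>2 - a\<^sup>2 + 1) / (2 * (a * b))"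
      using ab(1,2) by (simp add: field_simps power2_eq_square)
    also have "b\<^sup>2 - a\<^sup>2 + 1 = 2 * b\<^sup>2" using ab(3) by simp
    also have "2 * b\<^sup>2 / (2 * (a * b)) = b / a"
      using ab(1,2) by (simp add: field_simps power2_eq_square)
    finally show ?thesis .
  qed
  also have "b / a = cn y / sn y" using assms by (simp add: a_def b_def sn_eq cn_eq)
  finally show ?thesis
    by (rule has_field_derivative_transform_within_open[where S = "{0<..<1/2}"])
      (use assms in \<open>auto simp: profile_def sn_eq cn_eq\<close>)
qed

text \<open>A centre curve, parametrised by the height. It ends in the circle \<open>y = 0\<close> at the point \<open>\<alpha>\<close>.\<close>

definition centre_arc :: "real \<Rightarrow> real \<Rightarrow> real^2" where
  "centre_arc \<alpha> y = vector [\<alpha> + profile y, y]"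

lemma sn_pos: "0 < y \<Longrightarrow> y < 1/2 \<Longrightarrow> sn y > 0"
  by (simp add: sn_eq)

text \<open>A parametrisation of a leaf may be shifted by an integer vector, so that it starts at a given lift. Its speed
  along \<open>cent\<close> is continuous without zeros and thus has constant sign; after reversing time if necessary
  it is negative. For \<open>\<bar>y\<bar> < 1/2\<close> the curve then moves to the left, and towards the circle \<open>y = 0\<close>.\<close>

lemma leaf_curve:
  assumes E: "\<And>x. E (torus_proj x) = span {cent (x $ 2)}"
    and L: "C1_curve_tangent_to E L" and z: "torus_proj z \<in> L"
  obtains e k where "e 0 = z" "\<And>t. torus_proj (e t) \<in> L" "\<And>t. k t < 0"
    "\<And>t. ((\<lambda>s. e s $ 1) has_real_derivative k t * cn (e t $ 2)) (at t)"
    "\<And>t. ((\<lambda>s. e s $ 2) has_real_derivative k t * sn (e t $ 2)) (at t)"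
proof -
  obtain c c' where c: "L = range (\<lambda>t::real. torus_proj (c t))"
    and dc: "\<And>t. (c has_vector_derivative c' t) (at t)" and cc': "continuous_on UNIV c'"
    and c'E: "\<And>t. c' t \<noteq> 0 \<and> c' t \<in> E (torus_proj (c t))"
    using L unfolding C1_curve_tangent_to_def by blast
  obtain t0 where t0: "torus_proj z = torus_proj (c t0)" using z c by blast
  define d where "d t = c t + (z - c t0)" for t
  have pd: "torus_proj (d t) = torus_proj (c t)" for t
    unfolding d_def using t0 by (intro torus_proj_add_int) (simp add: torus_proj_eq_iff)
  have dd: "(d has_vector_derivative c' t) (at t)" for t
    unfolding d_def using has_vector_derivative_add[OF dc has_vector_derivative_const] by simp
  define k where "k t = c' t \<bullet> cent (d t $ 2)" for t
  have k: "c' t = k t *\<^sub>R cent (d t $ 2)" for t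
  proof -
    have "c' t \<in> span {cent (d t $ 2)}" using c'E[of t] E[of "d t"] pd[of t] by simp
    then obtain r where r: "c' t = r *\<^sub>R cent (d t $ 2)" by (auto simp: span_singleton)
    have "cent (d t $ 2) \<bullet> cent (d t $ 2) = 1"
      using cent_norm[of "d t $ 2"] by (simp add: norm_eq_sqrt_inner)
    then show ?thesis by (simp add: k_def r)
  qed
  have knz: "k t \<noteq> 0" for t using k[of t] c'E[of t] by auto
  have "continuous_on UNIV d"
    using dd by (auto intro!: continuous_at_imp_continuous_on has_vector_derivative_continuous)
  then have "continuous_on UNIV (\<lambda>t. d t $ 2)" by (intro continuous_intros)
  then have "continuous_on UNIV (\<lambda>t. cent (d t $ 2))"
    by (rule continuous_on_compose2[OF continuous_on_cent]) simp
  then have ck: "continuous_on UNIV k" unfolding k_def by (intro continuous_intros cc')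
  \<comment> \<open>Time is reversed iff the given parametrisation moves in the positive direction of \<open>cent\<close>.\<close>
  define s :: real where "s = (if k t0 < 0 then 1 else - 1)"
  have ks: "s * k t < 0" for t
  proof (rule ccontr)
    assume "\<not> s * k t < 0"
    then have "s * k t0 < 0" "s * k t > 0"
      using knz[of t0] knz[of t] by (auto simp: s_def split: if_splits)
    moreover have conn: "connected ((\<lambda>t. s * k t) ` UNIV)"
      by (intro connected_continuous_image continuous_intros ck) simp
    ultimately have "0 \<in> (\<lambda>t. s * k t) ` UNIV"
      using connectedD_interval[OF conn, of "s * k t0" "s * k t" 0] by auto
    then show False using knz by (auto simp: s_def split: if_splits)
  qed
  have comp: "((\<lambda>t. d t $ i) has_real_derivative c' t $ i) (at t)" for t i
    using bounded_linear.has_vector_derivative[OF bounded_linear_vec_nth dd]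
    by (simp add: has_real_derivative_iff_has_vector_derivative)
  have aff: "((\<lambda>u. t0 + s * u) has_real_derivative s) (at t)" for t
    by (auto intro!: derivative_eq_intros)
  have comp': "((\<lambda>u. d (t0 + s * u) $ i) has_real_derivative c' (t0 + s * t) $ i * s) (at t)" for t i
    by (rule DERIV_chain2[OF comp aff])
  show ?thesis
  proof (rule that[of "\<lambda>t. d (t0 + s * t)" "\<lambda>t. s * k (t0 + s * t)"])
    show "d (t0 + s * 0) = z" by (simp add: d_def)
    show "torus_proj (d (t0 + s * t)) \<in> L" for t by (simp add: pd c)
    show "s * k (t0 + s * t) < 0" for t by (rule ks)
    show "((\<lambda>u. d (t0 + s * u) $ 1) has_real_derivative s * k (t0 + s * t) * cn (d (t0 + s * t) $ 2)) (at t)" for t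
      using comp'[where i = 1 and t = t] unfolding k by (simp add: cent_def mult_ac)
    show "((\<lambda>u. d (t0 + s * u) $ 2) has_real_derivative s * k (t0 + s * t) * sn (d (t0 + s * t) $ 2)) (at t)" for t
      using comp'[where i = 2 and t = t] unfolding k by (simp add: cent_def mult_ac)
  qed
qed

lemma short_time:
  fixes h :: "real \<Rightarrow> real"
  assumes "continuous_on UNIV h" "open V" "h 0 \<in> V"
  obtains \<tau> where "\<tau> > 0" "\<And>t. 0 \<le> t \<Longrightarrow> t \<le> \<tau> \<Longrightarrow> h t \<in> V"
proof -
  have "open (h -` V)" by (rule open_vimage[OF assms(2,1)])
  moreover have "0 \<in> h -` V" using assms(3) by simp
  ultimately obtain e where e: "e > 0" "ball 0 e \<subseteq> h -` V" by (rule openE)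
  show ?thesis
    by (rule that[of "e / 2"]) (use e in \<open>auto simp: subset_iff\<close>)
qed

text \<open>Off the circle the centre direction is the slope of a graph over the height, so \<open>x - \<chi>(y)\<close> is constant along
  the leaf, and the height decreases strictly.\<close>

lemma leaf_continues_down_arc:
  assumes E: "\<And>x. E (torus_proj x) = span {cent (x $ 2)}"
    and L: "C1_curve_tangent_to E L" and z: "torus_proj (centre_arc \<alpha> m) \<in> L"
    and m: "0 < m" "m < 1/2"
  shows "\<exists>y0<m. \<forall>y\<in>{y0..m}. torus_proj (centre_arc \<alpha> y) \<in> L"
proof -
  obtain e k where e: "e 0 = centre_arc \<alpha> m" "\<And>t. torus_proj (e t) \<in> L" "\<And>t. k t < 0"
    and d1: "\<And>t. ((\<lambda>s. e s $ 1) has_real_derivative k t * cn (e t $ 2)) (at t)"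
    and d2: "\<And>t. ((\<lambda>s. e s $ 2) has_real_derivative k t * sn (e t $ 2)) (at t)"
    using leaf_curve[of E, OF E L z] by blast
  have c2: "continuous_on UNIV (\<lambda>s. e s $ 2)"
    by (rule DERIV_continuous_on[OF has_field_derivative_at_within[OF d2]])
  have e02: "e 0 $ 2 = m" "e 0 $ 1 = \<alpha> + profile m" by (simp_all add: e(1) centre_arc_def)
  have "e 0 $ 2 \<in> {0<..<1/2}" using m by (simp add: e02)
  then obtain \<tau> where \<tau>: "\<tau> > 0" "\<And>t. 0 \<le> t \<Longrightarrow> t \<le> \<tau> \<Longrightarrow> e t $ 2 \<in> {0<..<1/2}"
    by (rule short_time[OF c2 open_greaterThanLessThan]) blast
  have "e \<tau> $ 2 < e 0 $ 2"
  proof (rule DERIV_neg_imp_decreasing[OF \<tau>(1)])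
    fix t assume "0 \<le> t" "t \<le> \<tau>"
    then have "k t * sn (e t $ 2) < 0"
      using \<tau>(2)[of t] e(3)[of t] sn_pos[of "e t $ 2"] by (simp add: mult_less_0_iff)
    then show "\<exists>l. ((\<lambda>s. e s $ 2) has_real_derivative l) (at t) \<and> l < 0" using d2 by blast
  qed
  then have less: "e \<tau> $ 2 < m" by (simp add: e02)
  have const: "e t $ 1 - profile (e t $ 2) = \<alpha>" if t: "0 \<le> t" "t \<le> \<tau>" for t
  proof -
    have der: "((\<lambda>s. e s $ 1 - profile (e s $ 2)) has_real_derivative 0) (at u)" if "0 \<le> u" "u \<le> \<tau>" for u
    proof -
      have pos: "0 < e u $ 2" "e u $ 2 < 1/2" using \<tau>(2)[OF that] by auto
      have "((\<lambda>s. e s $ 1 - profile (e s $ 2)) has_real_derivative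
          k u * cn (e u $ 2) - cn (e u $ 2) / sn (e u $ 2) * (k u * sn (e u $ 2))) (at u)"
        by (intro DERIV_diff d1 DERIV_chain2[OF profile_deriv[OF pos] d2])
      then show ?thesis using sn_pos[OF pos] by simp
    qed
    have "\<exists>c. \<forall>u\<in>{0..\<tau>}. e u $ 1 - profile (e u $ 2) = c"
      by (rule has_field_derivative_zero_constant)
        (use der in \<open>auto intro: has_field_derivative_at_within\<close>)
    then obtain c where cst: "\<And>u. u \<in> {0..\<tau>} \<Longrightarrow> e u $ 1 - profile (e u $ 2) = c" by blast
    have "c = \<alpha>" using cst[of 0] \<tau>(1) by (simp add: e02)
    then show ?thesis using cst[of t] t by simp
  qed
  show ?thesis
  proof (rule exI[of _ "e \<tau> $ 2"], intro conjI less ballI)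
    fix y assume y: "y \<in> {e \<tau> $ 2..m}"
    have "\<exists>t\<ge>0. t \<le> \<tau> \<and> e t $ 2 = y"
      by (rule IVT2') (use y \<tau>(1) in \<open>auto simp: e02 intro: continuous_on_subset[OF c2]\<close>)
    then obtain t where t: "0 \<le> t" "t \<le> \<tau>" "e t $ 2 = y" by blast
    have "e t = centre_arc \<alpha> y"
      using const[OF t(1,2)] t(3) by (simp add: vector2_eq_iff centre_arc_def)
    then show "torus_proj (centre_arc \<alpha> y) \<in> L" using e(2)[of t] by simp
  qed
qed

text \<open>Moving to the left, a leaf satisfies \<open>(y\<^sup>2)' = 2 * y * k * sn y \<le> 0\<close>, because \<open>sn y\<close> has the sign of \<open>y\<close>
  and \<open>k\<close> is negative. So from \<open>y = 0\<close> on it remains in the circle.\<close>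

lemma leaf_stays_in_circle:
  assumes E: "\<And>x. E (torus_proj x) = span {cent (x $ 2)}"
    and L: "C1_curve_tangent_to E L" and z: "torus_proj (vector [0, 0]) \<in> L"
  shows "\<exists>\<delta>>0. \<forall>\<alpha>\<in>{-\<delta>..0}. torus_proj (vector [\<alpha>, 0]) \<in> L"
proof -
  obtain e k where e: "e 0 = vector [0, 0]" "\<And>t. torus_proj (e t) \<in> L" "\<And>t. k t < 0"
    and d1: "\<And>t. ((\<lambda>s. e s $ 1) has_real_derivative k t * cn (e t $ 2)) (at t)"
    and d2: "\<And>t. ((\<lambda>s. e s $ 2) has_real_derivative k t * sn (e t $ 2)) (at t)"
    using leaf_curve[of E, OF E L z] by blast
  have c1: "continuous_on UNIV (\<lambda>s. e s $ 1)" and c2: "continuous_on UNIV (\<lambda>s. e s $ 2)"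
    by (rule DERIV_continuous_on[OF has_field_derivative_at_within[OF d1]]
        DERIV_continuous_on[OF has_field_derivative_at_within[OF d2]])+
  have "e 0 $ 2 \<in> {-1/2<..<1/2}" by (simp add: e(1))
  then obtain \<tau> where \<tau>: "\<tau> > 0" "\<And>t. 0 \<le> t \<Longrightarrow> t \<le> \<tau> \<Longrightarrow> e t $ 2 \<in> {-1/2<..<1/2}"
    by (rule short_time[OF c2 open_greaterThanLessThan]) blast
  have on_circle: "e t $ 2 = 0" if t: "0 \<le> t" "t \<le> \<tau>" for t
  proof -
    have "(e t $ 2)\<^sup>2 \<le> (e 0 $ 2)\<^sup>2"
    proof (rule DERIV_nonpos_imp_nonincreasing[OF t(1)])
      fix u assume u: "0 \<le> u" "u \<le> t"
      let ?y = "e u $ 2"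
      have "\<bar>?y\<bar> \<le> 1/2" using \<tau>(2)[of u] u t by auto
      then have "?y * sn ?y \<ge> 0" by (simp add: sn_eq zero_le_mult_iff) linarith
      then have "2 * ?y * (k u * sn ?y) \<le> 0"
        using e(3)[of u] mult_nonpos_nonneg[of "k u" "?y * sn ?y"] by (simp add: mult_ac)
      moreover have "((\<lambda>s. (e s $ 2)\<^sup>2) has_real_derivative 2 * ?y * (k u * sn ?y)) (at u)"
        by (rule derivative_eq_intros d2 refl)+ simp
      ultimately show "\<exists>l. ((\<lambda>s. (e s $ 2)\<^sup>2) has_real_derivative l) (at u) \<and> l \<le> 0" by blast
    qed
    then show ?thesis by (simp add: e(1))
  qed
  have "e \<tau> $ 1 < e 0 $ 1"
  proof (rule DERIV_neg_imp_decreasing[OF \<tau>(1)])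
    fix t assume t: "0 \<le> t" "t \<le> \<tau>"
    show "\<exists>l. ((\<lambda>s. e s $ 1) has_real_derivative l) (at t) \<and> l < 0"
      using d1[of t] e(3)[of t] on_circle[OF t] by auto
  qed
  then have neg: "e \<tau> $ 1 < 0" by (simp add: e(1))
  show ?thesis
  proof (rule exI[of _ "- (e \<tau> $ 1)"], intro conjI ballI)
    show "- (e \<tau> $ 1) > 0" using neg by simp
    fix \<alpha> assume \<alpha>: "\<alpha> \<in> {- (- (e \<tau> $ 1))..0}"
    have "\<exists>t\<ge>0. t \<le> \<tau> \<and> e t $ 1 = \<alpha>"
      by (rule IVT2') (use \<alpha> \<tau>(1) in \<open>auto simp: e(1) intro: continuous_on_subset[OF c1]\<close>)
    then obtain t where t: "0 \<le> t" "t \<le> \<tau>" "e t $ 1 = \<alpha>" by blast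
    have "e t = vector [\<alpha>, 0]"
      using on_circle[OF t(1,2)] t(3) by (simp add: vector2_eq_iff)
    then show "torus_proj (vector [\<alpha>, 0]) \<in> L" using e(2)[of t] by simp
  qed
qed

lemma continuous_on_centre_arc: "continuous_on A (\<lambda>w. centre_arc (fst w) (snd w))"
  unfolding centre_arc_def by (intro continuous_intros)

text \<open>Let \<open>m\<close> be the infimum of the heights down to which the arc belongs to the leaf. The part above \<open>m\<close> lies
  in one plaque. A plaque is a level set in the chart and so contains the limit point at height \<open>m\<close>. If
  \<open>m\<close> were positive, the leaf would continue further down.\<close>

lemma leaf_reaches_circle:
  assumes E: "\<And>x. E (torus_proj x) = span {cent (x $ 2)}"
    and L: "C1_curve_tangent_to E L"
    and hom: "homeomorphism U ({0<..<1::real} \<times> {0<..<1::real}) \<phi> \<psi>"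
    and plaques: "\<forall>K\<in>components (L \<inter> U). \<exists>y. \<phi> ` K = {0<..<1} \<times> {y}"
    and \<epsilon>: "0 < \<epsilon>" "\<epsilon> < 1/2" and U: "\<And>y. y \<in> {0..\<epsilon>} \<Longrightarrow> torus_proj (centre_arc \<alpha> y) \<in> U"
    and top: "torus_proj (centre_arc \<alpha> \<epsilon>) \<in> L"
  shows "\<forall>y\<in>{0..\<epsilon>}. torus_proj (centre_arc \<alpha> y) \<in> L"
proof -
  define \<gamma> where "\<gamma> y = torus_proj (centre_arc \<alpha> y)" for y
  have c\<gamma>: "continuous_on A \<gamma>" for A
  proof -
    have "continuous_on A (\<lambda>y. centre_arc \<alpha> y)"
      unfolding centre_arc_def by (intro continuous_intros)
    then show ?thesis
      unfolding \<gamma>_def by (rule continuous_on_compose2[OF continuous_on_torus_proj[of UNIV]]) simp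
  qed
  define J where "J = {y \<in> {0..\<epsilon>}. \<forall>z\<in>{y..\<epsilon>}. \<gamma> z \<in> L}"
  have \<epsilon>J: "\<epsilon> \<in> J" using \<epsilon> top by (simp add: J_def \<gamma>_def)
  have bdd: "bdd_below J" by (rule bdd_belowI[of _ 0]) (simp add: J_def)
  define m where "m = Inf J"
  have m: "0 \<le> m" "m \<le> \<epsilon>"
    using \<epsilon>J bdd unfolding m_def by (auto intro!: cInf_greatest cInf_lower simp: J_def)
  have above: "\<gamma> z \<in> L" if z: "m < z" "z \<le> \<epsilon>" for z
  proof -
    obtain y where "y \<in> J" "y < z"
      using cInf_lessD[of J z] \<epsilon>J z(1) unfolding m_def by blast
    then show ?thesis using z(2) by (simp add: J_def)
  qed
  have "\<gamma> m \<in> L"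
  proof (cases "m = \<epsilon>")
    case True
    then show ?thesis using top by (simp add: \<gamma>_def)
  next
    case False
    then have m\<epsilon>: "m < \<epsilon>" using m by simp
    define K where "K = connected_component_set (L \<inter> U) (\<gamma> \<epsilon>)"
    have base: "\<gamma> \<epsilon> \<in> L \<inter> U" using top U[of \<epsilon>] \<epsilon> by (simp add: \<gamma>_def)
    have "K \<in> components (L \<inter> U)" unfolding K_def using base by (rule componentsI)
    then obtain h where h: "\<phi> ` K = {0<..<1} \<times> {h}" using plaques by blast
    have K: "\<gamma> z \<in> K" if z: "z \<in> {m<..\<epsilon>}" for z
    proof -
      have "connected (\<gamma> ` {z..\<epsilon>})" by (intro connected_continuous_image c\<gamma>) simp
      moreover have "\<gamma> ` {z..\<epsilon>} \<subseteq> L \<inter> U"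
        using above z U m by (auto simp: \<gamma>_def)
      ultimately have "\<gamma> ` {z..\<epsilon>} \<subseteq> K"
        unfolding K_def by (intro connected_component_maximal) (use z in auto)
      then show ?thesis using z by auto
    qed
    have cl: "closure {m<..\<epsilon>} = {m..\<epsilon>}" using m\<epsilon> by simp
    have "\<gamma> ` {m..\<epsilon>} \<subseteq> U" using U m by (auto simp: \<gamma>_def)
    then have "continuous_on (closure {m<..\<epsilon>}) (\<lambda>z. snd (\<phi> (\<gamma> z)))"
      unfolding cl by (intro continuous_on_snd continuous_on_compose2[OF homeomorphism_cont1[OF hom] c\<gamma>])
    moreover have "snd (\<phi> (\<gamma> z)) = h" if "z \<in> {m<..\<epsilon>}" for z
    proof -
      have "\<phi> (\<gamma> z) \<in> {0<..<1} \<times> {h}" using K[OF that] h by blast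
      then show ?thesis by auto
    qed
    moreover have "m \<in> closure {m<..\<epsilon>}" unfolding cl using m\<epsilon> by simp
    ultimately have hm: "snd (\<phi> (\<gamma> m)) = h"
      by (rule continuous_constant_on_closure)
    have mU: "\<gamma> m \<in> U" using U[of m] m by (simp add: \<gamma>_def)
    then have "\<phi> (\<gamma> m) \<in> {0<..<1} \<times> {0<..<1}" using homeomorphism_image1[OF hom] by blast
    then have "\<phi> (\<gamma> m) \<in> \<phi> ` K" using hm h by (auto simp: mem_Times_iff)
    then obtain q where q: "q \<in> K" "\<phi> (\<gamma> m) = \<phi> q" by blast
    have qLU: "q \<in> L \<inter> U" using q(1) connected_component_subset unfolding K_def by blast
    then have "\<gamma> m = q" using q(2) mU homeomorphism_apply1[OF hom] by (metis IntD2)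
    then show ?thesis using qLU by simp
  qed
  then have mJ: "m \<in> J" using above m unfolding J_def by (force simp: le_less)
  have "m = 0"
  proof (rule ccontr)
    assume "m \<noteq> 0"
    then have m0: "0 < m" "m < 1/2" using m \<epsilon> by auto
    obtain y0 where y0: "y0 < m" "\<forall>y\<in>{y0..m}. torus_proj (centre_arc \<alpha> y) \<in> L"
      using leaf_continues_down_arc[of E, OF E L _ m0] \<open>\<gamma> m \<in> L\<close> unfolding \<gamma>_def by blast
    define y where "y = max 0 y0"
    have "\<gamma> z \<in> L" if "z \<in> {y..\<epsilon>}" for z
      using that above[of z] y0(2) by (cases "z \<le> m") (auto simp: y_def \<gamma>_def)
    then have "y \<in> J" using y0(1) m m0 by (auto simp: J_def y_def)
    then have "m \<le> y" unfolding m_def by (rule cInf_lower[OF _ bdd])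
    then show False using y0(1) m0 by (simp add: y_def)
  qed
  then show ?thesis using mJ by (simp add: J_def \<gamma>_def)
qed

lemma open_subset_horizontal_empty:
  fixes B :: "(real \<times> real) set"
  assumes "open B" "B \<subseteq> UNIV \<times> {h}" shows "B = {}"
proof (rule ccontr)
  assume "B \<noteq> {}"
  then obtain s where s: "(s, h) \<in> B" using assms(2) by auto
  obtain A C where "open A" "open C" "(s, h) \<in> A \<times> C" "A \<times> C \<subseteq> B"
    by (rule open_prod_elim[OF assms(1) s])
  then have AC: "open A" "open C" "s \<in> A" "h \<in> C" "A \<times> C \<subseteq> B" by auto
  have "C \<subseteq> {h}" using AC(3,5) assms(2) by auto
  then have "C = {h}" using AC(4) by auto
  then show False using AC(2) not_open_singleton by metis
qed

text \<open>Let \<open>L\<close> be the leaf through the origin. It contains a segment of the circle to the left of the origin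
  and, leaves being disjoint, also all centre arcs that end in the segment. These arcs fill a curved
  rectangle, which is connected and therefore lies in a single plaque. But the rectangle has
  nonempty interior.\<close>

lemma no_foliation:
  assumes E: "\<And>x. E (torus_proj x) = span {cent (x $ 2)}"
  shows "\<not> foliation_tangent_to E W"
proof
  assume "foliation_tangent_to E W"
  then have cover: "\<Union>W = UNIV" and disj: "disjoint W"
    and tang: "\<And>L. L \<in> W \<Longrightarrow> C1_curve_tangent_to E L"
    and charts: "\<And>p. \<exists>U \<phi> \<psi>. open U \<and> p \<in> U \<and>
        homeomorphism U ({0<..<1::real} \<times> {0<..<1::real}) \<phi> \<psi> \<and>
        (\<forall>L\<in>W. \<forall>K\<in>components (L \<inter> U). \<exists>y. \<phi> ` K = {0<..<1} \<times> {y})"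
    unfolding foliation_tangent_to_def by blast+
  define o' :: "real^2" where "o' = vector [0, 0]"
  obtain U \<phi> \<psi> where U: "open U" "torus_proj o' \<in> U"
    and hom: "homeomorphism U ({0<..<1::real} \<times> {0<..<1::real}) \<phi> \<psi>"
    and plaques: "\<forall>L\<in>W. \<forall>K\<in>components (L \<inter> U). \<exists>y. \<phi> ` K = {0<..<1} \<times> {y}"
    using charts[of "torus_proj o'"] by (elim exE conjE)
  let ?\<Gamma> = "\<lambda>w. centre_arc (fst w) (snd w)"
  have "open (?\<Gamma> -` (torus_proj -` U))"
    by (rule open_vimage[OF open_torus_proj_vimage[OF U(1)] continuous_on_centre_arc])
  moreover have "(0, 0) \<in> ?\<Gamma> -` (torus_proj -` U)"
    using U(2) by (simp add: centre_arc_def o'_def)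
  ultimately obtain r where r: "r > 0" "ball (0, 0) r \<subseteq> ?\<Gamma> -` (torus_proj -` U)"
    by (rule openE)
  \<comment> \<open>Both coordinates up to \<open>\<epsilon>\<close> keep the arcs in the chart, and heights below \<open>1/2\<close>.\<close>
  define \<epsilon> where "\<epsilon> = min (r / 3) (1/3)"
  have \<epsilon>: "0 < \<epsilon>" "\<epsilon> < 1/2" using r(1) by (auto simp: \<epsilon>_def)
  have inU: "torus_proj (centre_arc \<alpha> y) \<in> U" if "\<alpha> \<in> {-\<epsilon>..0}" "y \<in> {0..\<epsilon>}" for \<alpha> y
  proof -
    have "norm (\<alpha>, y) \<le> \<bar>\<alpha>\<bar> + \<bar>y\<bar>" using norm_Pair_le[of \<alpha> y] by simp
    also have "\<dots> \<le> \<epsilon> + \<epsilon>" using that by auto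
    also have "\<dots> < r" using r(1) by (auto simp: \<epsilon>_def)
    finally have "norm (- (\<alpha>, y)) < r" unfolding norm_minus_cancel .
    then have "(\<alpha>, y) \<in> ball (0, 0) r" by (simp add: dist_norm)
    then show ?thesis using r(2) by auto
  qed
  have leaf: "\<exists>L\<in>W. p \<in> L" for p
    using cover[THEN equalityD2, THEN subsetD, OF UNIV_I, of p] by (rule UnionE) (rule bexI)
  obtain L where L: "L \<in> W" "torus_proj o' \<in> L" using leaf by (rule bexE)
  obtain \<delta>' where \<delta>': "\<delta>' > 0" "\<forall>\<alpha>\<in>{-\<delta>'..0}. torus_proj (vector [\<alpha>, 0]) \<in> L"
    using leaf_stays_in_circle[of E, OF E tang[OF L(1)] L(2)[unfolded o'_def]] by (elim exE conjE)
  define \<delta> where "\<delta> = min \<delta>' \<epsilon>"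
  have \<delta>: "\<delta> > 0" "\<delta> \<le> \<epsilon>" "\<delta> \<le> \<delta>'" using \<delta>'(1) \<epsilon>(1) by (auto simp: \<delta>_def)
  have inL: "torus_proj (centre_arc \<alpha> y) \<in> L" if \<alpha>: "\<alpha> \<in> {-\<delta>..0}" and y: "y \<in> {0..\<epsilon>}" for \<alpha> y
  proof -
    obtain L' where L': "L' \<in> W" "torus_proj (centre_arc \<alpha> \<epsilon>) \<in> L'" using leaf by (rule bexE)
    have "\<forall>y\<in>{0..\<epsilon>}. torus_proj (centre_arc \<alpha> y) \<in> L'"
    proof (rule leaf_reaches_circle[of E, OF E tang[OF L'(1)] hom _ \<epsilon> _ L'(2)])
      show "\<forall>K\<in>components (L' \<inter> U). \<exists>y. \<phi> ` K = {0<..<1} \<times> {y}" using plaques L'(1) by blast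
      show "torus_proj (centre_arc \<alpha> y) \<in> U" if "y \<in> {0..\<epsilon>}" for y
        using inU \<alpha> that \<delta> by auto
    qed
    then have all: "torus_proj (centre_arc \<alpha> 0) \<in> L'" "torus_proj (centre_arc \<alpha> y) \<in> L'"
      using \<epsilon> y by auto
    have "torus_proj (centre_arc \<alpha> 0) \<in> L"
      using \<delta>'(2) \<alpha> \<delta> by (simp add: centre_arc_def)
    then have "L' = L"
      using disj all(1) L(1) L'(1) unfolding disjoint_def by blast
    then show ?thesis using all(2) by simp
  qed
  define Q where "Q = {-\<delta>..0} \<times> {0..\<epsilon>}"
  define R where "R = (\<lambda>w. torus_proj (?\<Gamma> w)) ` Q"
  have "connected R"
    unfolding R_def Q_def
    by (intro connected_continuous_image connected_Times
        continuous_on_compose2[OF continuous_on_torus_proj[of UNIV] continuous_on_centre_arc]) auto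
  moreover have RLU: "R \<subseteq> L \<inter> U"
    unfolding R_def Q_def using inL inU \<delta> by force
  moreover have oR: "torus_proj o' \<in> R"
    unfolding R_def Q_def using \<delta> \<epsilon> by (intro image_eqI[of _ _ "(0, 0)"]) (auto simp: centre_arc_def o'_def)
  ultimately have RK: "R \<subseteq> connected_component_set (L \<inter> U) (torus_proj o')"
    by (intro connected_component_maximal)
  have "connected_component_set (L \<inter> U) (torus_proj o') \<in> components (L \<inter> U)"
    using L(2) U(2) by (intro componentsI) simp
  then obtain h where h: "\<phi> ` connected_component_set (L \<inter> U) (torus_proj o') = {0<..<1} \<times> {h}"
    using plaques L(1) by blast
  define V where "V = {v :: real^2. 0 < v $ 2 \<and> v $ 2 < \<epsilon> \<and> - \<delta> < v $ 1 - profile (v $ 2) \<and> v $ 1 - profile (v $ 2) < 0}"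
  have "open V"
    unfolding V_def by (intro open_Collect_conj open_Collect_less continuous_intros)
  then have openP: "open (torus_proj ` V)" by (rule open_torus_proj_image)
  have VR: "torus_proj ` V \<subseteq> R"
  proof
    fix p assume "p \<in> torus_proj ` V"
    then obtain v where v: "v \<in> V" "p = torus_proj v" by blast
    have "v = ?\<Gamma> (v $ 1 - profile (v $ 2), v $ 2)" by (simp add: centre_arc_def vector2_eq_iff)
    moreover have "(v $ 1 - profile (v $ 2), v $ 2) \<in> Q" using v(1) by (auto simp: V_def Q_def)
    ultimately show "p \<in> R" unfolding R_def v(2) by (rule image_eqI[OF arg_cong])
  qed
  have VU: "torus_proj ` V \<subseteq> U" using VR RLU by blast
  have "open (\<psi> -` (torus_proj ` V) \<inter> {0<..<1} \<times> {0<..<1})"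
    using homeomorphism_cont2[OF hom] openP
      continuous_on_open_vimage[of "{0<..<1::real} \<times> {0<..<1::real}" \<psi>]
    by (simp add: open_Times)
  moreover have "\<psi> -` (torus_proj ` V) \<inter> {0<..<1} \<times> {0<..<1} = \<phi> ` torus_proj ` V" (is "?A = ?B")
  proof
    show "?A \<subseteq> ?B"
    proof
      fix w assume w: "w \<in> ?A"
      then have "\<phi> (\<psi> w) = w" using homeomorphism_apply2[OF hom] by blast
      then show "w \<in> ?B" using w by (metis IntD1 imageI vimageD)
    qed
    show "?B \<subseteq> ?A"
    proof
      fix w assume "w \<in> ?B"
      then obtain q where q: "q \<in> torus_proj ` V" "w = \<phi> q" by blast
      then have "\<psi> w = q" "w \<in> {0<..<1} \<times> {0<..<1}"
        using VU homeomorphism_apply1[OF hom] homeomorphism_image1[OF hom] by blast+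
      then show "w \<in> ?A" using q(1) by blast
    qed
  qed
  ultimately have openB: "open (\<phi> ` torus_proj ` V)" by (simp only:)
  have "\<phi> ` torus_proj ` V \<subseteq> {0<..<1} \<times> {h}"
    unfolding h[symmetric] by (intro image_mono order_trans[OF VR RK])
  also have "\<dots> \<subseteq> UNIV \<times> {h}" by (intro Sigma_mono) auto
  finally have "\<phi> ` torus_proj ` V = {}" by (rule open_subset_horizontal_empty[OF openB])
  moreover have "vector [profile (\<epsilon> / 2) - \<delta> / 2, \<epsilon> / 2] \<in> V" using \<epsilon> \<delta> by (simp add: V_def)
  ultimately show False by blast
qed

lemma not_dynamically_coherent_endo: "\<not> dynamically_coherent endo"
  unfolding dynamically_coherent_def
proof (intro notI, elim exE conjE)
  fix C E W
  assume "unstable_cone_family endo C" "centre_direction endo C E" and W: "foliation_tangent_to E W"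
  then have "E (torus_proj x) = span {cent (x $ 2)}" for x by (intro centre_direction_eq)
  then show False using no_foliation W by blast
qed

theorem theoremC:
  "\<exists>f. partially_hyperbolic f \<and>
       (\<exists>A. is_linearisation f A \<and> non_hyperbolic A) \<and>
       \<not> dynamically_coherent f"
  using partially_hyperbolic_endo is_linearisation_endo non_hyperbolic_linearisation
    not_dynamically_coherent_endo by blast

end
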